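(* Let $\alpha\in\mathbb R$, let $\kappa\in\mathbb N\cup\{+\infty\}$, and let $(s_j)_{j=0}^\kappa$ be a sequence of complex $q\times q$ matrices. Let $(s_j^{[1,\alpha]})_{j=0}^{\kappa-1}$ be the first $\alpha$-Schur transform of $(s_j)_{j=0}^\kappa$. Then: (a) If $(s_j)_{j=0}^\kappa\in\mathcal K^{\ge}_{q,\kappa,\alpha}$, then $(s_j^{[1,\alpha]})_{j=0}^{\kappa-1}\in\mathcal K^{\ge}_{q,\kappa-1,\alpha}$. (b) If $(s_j)_{j=0}^\kappa\in\mathcal K^{\ge,e}_{q,\kappa,\alpha}$, then $(s_j^{[1,\alpha]})_{j=0}^{\kappa-1}\in\mathcal K^{\ge,e}_{q,\kappa-1,\alpha}$. (c) If $(s_j)_{j=0}^\kappa\in\mathcal K^{>}_{q,\kappa,\alpha}$, then $(s_j^{[1,\alpha]})_{j=0}^{\kappa-1}\in\mathcal K^{>}_{q,\kappa-1,\alpha}$. (d) If $m$ is an integer with $0\le m\le\kappa$ and $(s_j)_{j=0}^\kappa\in\mathcal K^{\ge,cd,m}_{q,\kappa,\alpha}$, then $(s_j^{[1,\alpha]})_{j=0}^{\kappa-1}\in\mathcal K^{\ge,cd,\max\{0,m-1\}}_{q,\kappa-1,\alpha}$. (e) If $(s_j)_{j=0}^\kappa\in\mathcal K^{\ge,cd}_{q,\kappa,\alpha}$, then $(s_j^{[1,\alpha]})_{j=0}^{\kappa-1}\in\mathcal K^{\ge,cd}_{q,\kappa-1,\alpha}$.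
   Context: Let $q\in\mathbb N=\{1,2,\dots\}$; $\mathbb N_0=\{0,1,2,\dots\}$. All sequences consist of complex $q\times q$ matrices; $(s_j)_{j=0}^{\infty}$ is indexed by $\mathbb N_0$, and $\infty-1=\infty$. $A\ge0$ (resp. $A>0$) means that $A$ is nonnegative (resp. positive) Hermitian, i.e. Hermitian positive semidefinite (resp. definite), and $A^\dagger$ is the Moore–Penrose inverse of $A$. Block Hankel matrices. For a sequence $(s_j)$ put $H_n=[s_{j+k}]_{j,k=0}^n$, $s_{\alpha,j}=-\alpha s_j+s_{j+1}$, and $H_{\alpha,n}=[s_{\alpha,j+k}]_{j,k=0}^n$ (whenever the entries are available). Put $L_0=s_0$ and, for $n\ge1$, $L_n=s_{2n}-[s_n,\dots,s_{2n-1}]\,H_{n-1}^\dagger\,\begin{bmatrix}s_n\\ \vdots\\ s_{2n-1}\end{bmatrix}$; let $L_{\alpha,n}$ be the matrix built in the same way from $(s_{\alpha,j})$ in place of $(s_j)$ (so $L_{\alpha,0}=s_{\alpha,0}$). Classes. $\mathcal K^{\ge}_{q,0,\alpha}$: all $(s_j)_{j=0}^0$ with $s_0\ge0$. For $n\ge1$, $\mathcal K^{\ge}_{q,2n,\alpha}$: all $(s_j)_{j=0}^{2n}$ with $H_n\ge0$ and $H_{\alpha,n-1}\ge0$. For $n\ge0$, $\mathcal K^{\ge}_{q,2n+1,\alpha}$: all $(s_j)_{j=0}^{2n+1}$ with $H_n\ge0$ and $H_{\alpha,n}\ge0$. $\mathcal K^{>}_{q,m,\alpha}$ is defined in the same way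 with $>0$ in place of $\ge0$ everywhere. $\mathcal K^{\ge}_{q,\infty,\alpha}$ (resp. $\mathcal K^{>}_{q,\infty,\alpha}$): all $(s_j)_{j=0}^\infty$ with $(s_j)_{j=0}^m\in\mathcal K^{\ge}_{q,m,\alpha}$ (resp. $\mathcal K^{>}_{q,m,\alpha}$) for all $m\in\mathbb N_0$. For $m\in\mathbb N_0$, $\mathcal K^{\ge,e}_{q,m,\alpha}$: all $(s_j)_{j=0}^m$ for which there is a complex $q\times q$ matrix $s_{m+1}$ with $(s_j)_{j=0}^{m+1}\in\mathcal K^{\ge}_{q,m+1,\alpha}$; $\mathcal K^{\ge,e}_{q,\infty,\alpha}=\mathcal K^{\ge}_{q,\infty,\alpha}$. For $n\ge0$, $\mathcal K^{\ge,cd}_{q,2n,\alpha}$: all $(s_j)_{j=0}^{2n}\in\mathcal K^{\ge}_{q,2n,\alpha}$ with $L_n=0$; $\mathcal K^{\ge,cd}_{q,2n+1,\alpha}$: all $(s_j)_{j=0}^{2n+1}\in\mathcal K^{\ge}_{q,2n+1,\alpha}$ with $L_{\alpha,n}=0$; $\mathcal K^{\ge,cd}_{q,\infty,\alpha}$: all $(s_j)_{j=0}^\infty\in\mathcal K^{\ge}_{q,\infty,\alpha}$ for which there is $m\in\mathbb N_0$ with $(s_j)_{j=0}^m\in\mathcal K^{\ge,cd}_{q,m,\alpha}$. For an integer $0\le m\le\kappa$, $\mathcal K^{\ge,cd,m}_{q,\kappa,\alpha}$: all $(s_j)_{j=0}^\kappa\in\mathcal K^{\ge}_{q,\kappa,\alpha}$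 with $(s_j)_{j=0}^m\in\mathcal K^{\ge,cd}_{q,m,\alpha}$. First $\alpha$-Schur transform. The $[+,\alpha]$-transform of $(s_j)$ is $(u_j)$ with $u_j=-\alpha s_{j-1}+s_j$, where $s_{-1}=0$. The reciprocal sequence of a sequence $(u_j)$ is given by $u_0^\sharp=u_0^\dagger$ and $u_j^\sharp=-u_0^\dagger\sum_{l=0}^{j-1}u_{j-l}u_l^\sharp$ for $j\ge1$. Put $s_j^{\sharp,\alpha}=u_j^\sharp$ where $(u_j)$ is the $[+,\alpha]$-transform of $(s_j)$. The first $\alpha$-Schur transform of $(s_j)_{j=0}^{\kappa}$ is $(s_j^{[1,\alpha]})_{j=0}^{\kappa-1}$ with $s_j^{[1,\alpha]}=-s_0\,s_{j+1}^{\sharp,\alpha}\,s_0$. *)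

theory Defs
  imports
    "Jordan_Normal_Form.Schur_Decomposition"
    "HOL-Library.Extended_Nat"
begin

text \<open>The relations \<open>\<le>\<close> and \<open><\<close> on complex numbers are those of
  \<open>HOL-Library.Complex_Order\<close>: \<open>0 \<le> z\<close> means that \<open>z\<close> is real and nonnegative.\<close>

definition hermitian :: "complex mat \<Rightarrow> bool" where
  "hermitian A \<longleftrightarrow> square_mat A \<and> mat_adjoint A = A"

definition nonneg_hermitian :: "complex mat \<Rightarrow> bool" where
  "nonneg_hermitian A \<longleftrightarrow>
     hermitian A \<and> (\<forall>v \<in> carrier_vec (dim_row A). 0 \<le> (A *\<^sub>v v) \<bullet>c v)"

definition pos_hermitian :: "complex mat \<Rightarrow> bool" where
  "pos_hermitian A \<longleftrightarrow>
     hermitian A \<and> (\<forall>v \<in> carrier_vec (dim_row A). v \<noteq> 0\<^sub>v (dim_row A) \<longrightarrow> 0 < (A *\<^sub>v v) \<bullet>c v)"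

definition is_moore_penrose :: "complex mat \<Rightarrow> complex mat \<Rightarrow> bool" where
  "is_moore_penrose A X \<longleftrightarrow>
     X \<in> carrier_mat (dim_col A) (dim_row A) \<and>
     A * X * A = A \<and> X * A * X = X \<and>
     mat_adjoint (A * X) = A * X \<and> mat_adjoint (X * A) = X * A"

text \<open>Every complex matrix satisfies these equations with exactly one \<open>X\<close>.\<close>

definition moore_penrose :: "complex mat \<Rightarrow> complex mat" where
  "moore_penrose A = (THE X. is_moore_penrose A X)"

text \<open>A sequence \<open>(s\<^sub>j)\<close> with last index \<open>\<kappa> \<le> \<infinity>\<close> is a function on all of \<open>nat\<close> whose
  values beyond \<open>\<kappa>\<close> are irrelevant. None of the notions below depends on them: for a class with
  last index \<open>\<kappa>\<close>, membership is decided by the entries with index at most \<open>\<kappa>\<close>. In particular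
  \<open>s\<close> itself also stands for each of its truncations.\<close>

type_synonym mat_seq = "nat \<Rightarrow> complex mat"

text \<open>Block matrices with blocks of size \<open>q\<close>: the entry \<open>(i, k)\<close> lies in block
  \<open>(i div q, k div q)\<close> at position \<open>(i mod q, k mod q)\<close>.\<close>

definition block_hankel :: "nat \<Rightarrow> mat_seq \<Rightarrow> nat \<Rightarrow> complex mat" where
  "block_hankel q s n =
     mat (Suc n * q) (Suc n * q) (\<lambda>(i, k). s (i div q + k div q) $$ (i mod q, k mod q))"

text \<open>The block row \<open>[s\<^sub>a, \<dots>, s\<^sub>b]\<close> and the block column with the same entries.\<close>

definition block_row :: "nat \<Rightarrow> mat_seq \<Rightarrow> nat \<Rightarrow> nat \<Rightarrow> complex mat" where
  "block_row q s a b =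
     mat q ((Suc b - a) * q) (\<lambda>(i, k). s (a + k div q) $$ (i, k mod q))"

definition block_col :: "nat \<Rightarrow> mat_seq \<Rightarrow> nat \<Rightarrow> nat \<Rightarrow> complex mat" where
  "block_col q s a b =
     mat ((Suc b - a) * q) q (\<lambda>(i, k). s (a + i div q) $$ (i mod q, k))"

definition shifted_seq :: "real \<Rightarrow> mat_seq \<Rightarrow> mat_seq" where
  "shifted_seq \<alpha> s j = complex_of_real (- \<alpha>) \<cdot>\<^sub>m s j + s (Suc j)"

definition L_mat :: "nat \<Rightarrow> mat_seq \<Rightarrow> nat \<Rightarrow> complex mat" where
  "L_mat q s n =
     (if n = 0 then s 0
      else s (2 * n) - block_row q s n (2 * n - 1) * moore_penrose (block_hankel q s (n - 1))
                         * block_col q s n (2 * n - 1))"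

definition K_nonneg_fin :: "nat \<Rightarrow> real \<Rightarrow> nat \<Rightarrow> mat_seq set" where
  "K_nonneg_fin q \<alpha> m = {s. (\<forall>j\<le>m. s j \<in> carrier_mat q q) \<and>
     (if m = 0 then nonneg_hermitian (s 0)
      else if even m then
        nonneg_hermitian (block_hankel q s (m div 2)) \<and>
        nonneg_hermitian (block_hankel q (shifted_seq \<alpha> s) (m div 2 - 1))
      else
        nonneg_hermitian (block_hankel q s (m div 2)) \<and>
        nonneg_hermitian (block_hankel q (shifted_seq \<alpha> s) (m div 2)))}"

definition K_pos_fin :: "nat \<Rightarrow> real \<Rightarrow> nat \<Rightarrow> mat_seq set" where
  "K_pos_fin q \<alpha> m = {s. (\<forall>j\<le>m. s j \<in> carrier_mat q q) \<and>
     (if m = 0 then pos_hermitian (s 0)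
      else if even m then
        pos_hermitian (block_hankel q s (m div 2)) \<and>
        pos_hermitian (block_hankel q (shifted_seq \<alpha> s) (m div 2 - 1))
      else
        pos_hermitian (block_hankel q s (m div 2)) \<and>
        pos_hermitian (block_hankel q (shifted_seq \<alpha> s) (m div 2)))}"

definition K_nonneg :: "nat \<Rightarrow> real \<Rightarrow> enat \<Rightarrow> mat_seq set" where
  "K_nonneg q \<alpha> \<kappa> = (case \<kappa> of enat m \<Rightarrow> K_nonneg_fin q \<alpha> m | \<infinity> \<Rightarrow> (\<Inter>m. K_nonneg_fin q \<alpha> m))"

definition K_pos :: "nat \<Rightarrow> real \<Rightarrow> enat \<Rightarrow> mat_seq set" where
  "K_pos q \<alpha> \<kappa> = (case \<kappa> of enat m \<Rightarrow> K_pos_fin q \<alpha> m | \<infinity> \<Rightarrow> (\<Inter>m. K_pos_fin q \<alpha> m))"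

text \<open>The extendable sequences \<open>\<K>\<^sup>\<ge>\<^sup>,\<^sup>e\<close>.\<close>

definition K_ext :: "nat \<Rightarrow> real \<Rightarrow> enat \<Rightarrow> mat_seq set" where
  "K_ext q \<alpha> \<kappa> = (case \<kappa> of
       enat m \<Rightarrow> {s. \<exists>X \<in> carrier_mat q q. s(Suc m := X) \<in> K_nonneg_fin q \<alpha> (Suc m)}
     | \<infinity> \<Rightarrow> K_nonneg q \<alpha> \<infinity>)"

text \<open>The completely degenerate sequences \<open>\<K>\<^sup>\<ge>\<^sup>,\<^sup>c\<^sup>d\<close>, and those that are completely
  degenerate of order \<open>m\<close> (used for \<open>m \<le> \<kappa>\<close> only).\<close>

definition K_cd_fin :: "nat \<Rightarrow> real \<Rightarrow> nat \<Rightarrow> mat_seq set" where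
  "K_cd_fin q \<alpha> m = {s \<in> K_nonneg_fin q \<alpha> m.
     if even m then L_mat q s (m div 2) = 0\<^sub>m q q
     else L_mat q (shifted_seq \<alpha> s) (m div 2) = 0\<^sub>m q q}"

definition K_cd :: "nat \<Rightarrow> real \<Rightarrow> enat \<Rightarrow> mat_seq set" where
  "K_cd q \<alpha> \<kappa> = (case \<kappa> of
       enat m \<Rightarrow> K_cd_fin q \<alpha> m
     | \<infinity> \<Rightarrow> {s \<in> K_nonneg q \<alpha> \<infinity>. \<exists>m. s \<in> K_cd_fin q \<alpha> m})"

definition K_cd_order :: "nat \<Rightarrow> real \<Rightarrow> enat \<Rightarrow> nat \<Rightarrow> mat_seq set" where
  "K_cd_order q \<alpha> \<kappa> m = {s \<in> K_nonneg q \<alpha> \<kappa>. s \<in> K_cd_fin q \<alpha> m}"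

text \<open>The \<open>[+,\<alpha>]\<close>-transform; the case distinction encodes \<open>s\<^sub>-\<^sub>1 = 0\<close>.\<close>

definition plus_transform :: "real \<Rightarrow> mat_seq \<Rightarrow> mat_seq" where
  "plus_transform \<alpha> s j =
     (case j of 0 \<Rightarrow> s 0 | Suc i \<Rightarrow> complex_of_real (- \<alpha>) \<cdot>\<^sub>m s i + s (Suc i))"

text \<open>The list sum below is the sum over \<open>l = 0, \<dots>, j\<close>; type \<open>mat\<close> has no zero element
  common to all dimensions, so \<open>sum\<close> is not available.\<close>

fun reciprocal_seq :: "nat \<Rightarrow> mat_seq \<Rightarrow> mat_seq" where
  "reciprocal_seq q u 0 = moore_penrose (u 0)"
| "reciprocal_seq q u (Suc j) =
     - (moore_penrose (u 0) *
        foldr (+) (map (\<lambda>l. u (Suc j - l) * reciprocal_seq q u l) [0..<Suc j]) (0\<^sub>m q q))"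

definition schur_transform :: "nat \<Rightarrow> real \<Rightarrow> mat_seq \<Rightarrow> mat_seq" where
  "schur_transform q \<alpha> s j = - (s 0 * reciprocal_seq q (plus_transform \<alpha> s) (Suc j) * s 0)"

end

theory Submission
  imports
    Defs
    "HOL-Computational_Algebra.Formal_Power_Series"
begin

text \<open>
  Let \<open>S(z)\<close> be the generating function of \<open>s\<close>, \<open>U(z) = (1 - \<alpha> z) S(z)\<close> that of its \<open>[+,\<alpha>]\<close>-transform, and
  \<open>T(z)\<close> that of the Schur transform \<open>t\<close>. Up to the outer factors \<open>s\<^sub>0\<close>, \<open>z T(z)\<close> is \<open>s\<^sub>0\<^sup>\<dagger> - U\<^sup>\<sharp>(z)\<close>. A block
  Hankel matrix \<open>[f\<^sub>j\<^sub>+\<^sub>k]\<close> has the generating kernel \<open>(x F(x) - y F(y)) / (x - y)\<close>, and for an inverse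
  \<open>R\<close> of \<open>V\<close> one has \<open>R(x) (V(x) - V(y)) R(y) = R(y) - R(x)\<close>. Read coefficientwise, with power series as
  block Toeplitz matrices, this gives two congruences:

  \<^item> \<open>[t\<^sub>j\<^sub>+\<^sub>k] = A H\<^sub>\<alpha>\<^sub>,\<^sub>n A\<^sup>*\<close>, where \<open>A\<close> is the block Toeplitz matrix of \<open>s\<^sub>0 U\<^sup>\<sharp>\<close>
    (lemma \<open>hankel_t\<close>);
  \<^item> \<open>[t\<^sub>\<alpha>\<^sub>,\<^sub>j\<^sub>+\<^sub>k] = B H\<^sub>n\<^sub>+\<^sub>1 B\<^sup>*\<close>, where \<open>B\<close> is the block Toeplitz matrix of \<open>s\<^sub>0 S\<^sup>\<sharp>\<close> without its
    first block row (lemma \<open>hankel_t_shifted\<close>).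

  So the two families of Hankel matrices exchange their roles and the length drops by one. Nonnegativity
  is inherited immediately, and extendability with it, since the transform of an extension extends the
  transform. If \<open>s\<^sub>0\<close> is invertible, \<open>A\<^sup>*\<close> and \<open>B\<^sup>*\<close> have left inverses, which gives definiteness.

  The condition \<open>L\<^sub>n = 0\<close> says that the kernel of \<open>H\<^sub>n\<close> contains a block column ending in the identity
  (\<open>schur_complement_eq_0_iff\<close>). The Toeplitz matrix of \<open>S\<close> or \<open>U\<close> inverts that of the reciprocal, so it
  carries such a column to a kernel column of the transformed matrix (\<open>kernel_transport\<close>).

  The matrix \<open>s\<^sub>0\<close> may be singular, so all inverses are inverses relative to the orthogonal projection \<open>P\<close>
  onto its range. The Schur transform sees only the compressed entries \<open>P s\<^sub>j P\<close> (\<open>reciprocal_seq_emb\<close>),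
  so the two congruences hold for arbitrary Hermitian sequences. In the degenerate case the compression has to
  be undone: there \<open>P s\<^sub>j P = s\<^sub>j\<close> by \<open>hankel_range\<close> and, for the last entry, \<open>degenerate_last\<close>.
\<close>

section \<open>The *-algebra of finitely supported complex matrices\<close>

text \<open>Matrices of all sizes, padded with zeros, live in one ring without unit. In contrast to the carrier-based
type of matrices, associativity and distributivity hold here unconditionally, and finite sums of matrices
are ordinary sums, so block matrices and power series with matrix coefficients become manageable.\<close>

typedef finmat = "{f :: nat \<Rightarrow> nat \<Rightarrow> complex. \<exists>N. \<forall>i j. f i j \<noteq> 0 \<longrightarrow> i < N \<and> j < N}"
  morphisms entry Abs_finmat
  by (intro exI[of _ "\<lambda>_ _. 0"]) auto

setup_lifting type_definition_finmat

lemma entry_bound: obtains N where "\<And>i j. entry A i j \<noteq> 0 \<Longrightarrow> i < N \<and> j < N"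
  using entry[of A] by auto

lemma finmat_eqI: "(\<And>i j. entry A i j = entry B i j) \<Longrightarrow> A = B"
  by (simp add: entry_inject[symmetric] fun_eq_iff)

instantiation finmat :: real_algebra
begin

lift_definition zero_finmat :: finmat is "\<lambda>_ _. 0" by auto

lift_definition plus_finmat :: "finmat \<Rightarrow> finmat \<Rightarrow> finmat" is "\<lambda>f g i j. f i j + g i j"
proof -
  fix f g :: "nat \<Rightarrow> nat \<Rightarrow> complex"
  assume "\<exists>N. \<forall>i j. f i j \<noteq> 0 \<longrightarrow> i < N \<and> j < N" "\<exists>N. \<forall>i j. g i j \<noteq> 0 \<longrightarrow> i < N \<and> j < N"
  then obtain M N where "\<forall>i j. f i j \<noteq> 0 \<longrightarrow> i < M \<and> j < M" "\<forall>i j. g i j \<noteq> 0 \<longrightarrow> i < N \<and> j < N"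
    by blast
  then show "\<exists>N. \<forall>i j. f i j + g i j \<noteq> 0 \<longrightarrow> i < N \<and> j < N"
    by (intro exI[of _ "max M N"]) (metis add.right_neutral max.strict_coboundedI1 max.strict_coboundedI2)
qed

lift_definition uminus_finmat :: "finmat \<Rightarrow> finmat" is "\<lambda>f i j. - f i j" by auto

definition minus_finmat :: "finmat \<Rightarrow> finmat \<Rightarrow> finmat" where "minus_finmat A B = A + - B"

lift_definition scaleR_finmat :: "real \<Rightarrow> finmat \<Rightarrow> finmat" is "\<lambda>c f i j. c *\<^sub>R f i j"
  by (metis scaleR_zero_right)

lift_definition times_finmat :: "finmat \<Rightarrow> finmat \<Rightarrow> finmat"
  is "\<lambda>f g i j. \<Sum>l | f i l \<noteq> 0. f i l * g l j"
proof -
  fix f g :: "nat \<Rightarrow> nat \<Rightarrow> complex"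
  assume "\<exists>N. \<forall>i j. f i j \<noteq> 0 \<longrightarrow> i < N \<and> j < N" "\<exists>N. \<forall>i j. g i j \<noteq> 0 \<longrightarrow> i < N \<and> j < N"
  then obtain M N where MN: "\<forall>i j. f i j \<noteq> 0 \<longrightarrow> i < M \<and> j < M" "\<forall>i j. g i j \<noteq> 0 \<longrightarrow> i < N \<and> j < N"
    by blast
  show "\<exists>N. \<forall>i j. (\<Sum>l | f i l \<noteq> 0. f i l * g l j) \<noteq> 0 \<longrightarrow> i < N \<and> j < N"
  proof (intro exI[of _ "max M N"] allI impI)
    fix i j assume "(\<Sum>l | f i l \<noteq> 0. f i l * g l j) \<noteq> 0"
    then obtain l where "f i l * g l j \<noteq> 0" by (metis (no_types, lifting) sum.neutral)
    then show "i < max M N \<and> j < max M N" using MN by fastforce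
  qed
qed

lemma entry_mult:
  assumes "\<And>l. entry A i l \<noteq> 0 \<Longrightarrow> l < N"
  shows "entry (A * B) i j = (\<Sum>l<N. entry A i l * entry B l j)"
  unfolding times_finmat.rep_eq
  using assms by (intro sum.mono_neutral_left) auto

instance
proof
  fix A B C :: finmat and a b :: real
  show "A + B + C = A + (B + C)" "A + B = B + A" "0 + A = A" "- A + A = 0" "A - B = A + - B"
    "a *\<^sub>R (A + B) = a *\<^sub>R A + a *\<^sub>R B" "(a + b) *\<^sub>R A = a *\<^sub>R A + b *\<^sub>R A"
    "a *\<^sub>R b *\<^sub>R A = (a * b) *\<^sub>R A" "1 *\<^sub>R A = A"
    by (rule finmat_eqI; simp add: plus_finmat.rep_eq uminus_finmat.rep_eq zero_finmat.rep_eq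
        minus_finmat_def scaleR_finmat.rep_eq algebra_simps)+
  obtain M where M: "\<And>i j. entry A i j \<noteq> 0 \<Longrightarrow> i < M \<and> j < M"
    using entry_bound[of A] by blast
  obtain N where N: "\<And>i j. entry B i j \<noteq> 0 \<Longrightarrow> i < N \<and> j < N"
    using entry_bound[of B] by blast
  have AN: "entry (A * X) i j = (\<Sum>l<M. entry A i l * entry X l j)" for X i j
    by (rule entry_mult) (use M in blast)
  have BN: "entry (B * X) i j = (\<Sum>l<N. entry B i l * entry X l j)" for X i j
    by (rule entry_mult) (use N in blast)
  show "A * B * C = A * (B * C)"
  proof (rule finmat_eqI)
    fix i j
    have AB: "l < N" if "entry (A * B) i l \<noteq> 0" for l
    proof (rule ccontr)
      assume "\<not> l < N"
      then have "entry B k l = 0" for k using N by blast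
      then show False using that unfolding AN by simp
    qed
    have "entry (A * B * C) i j = (\<Sum>l<N. entry (A * B) i l * entry C l j)"
      by (rule entry_mult) (use AB in blast)
    also have "\<dots> = (\<Sum>l<N. \<Sum>k<M. entry A i k * entry B k l * entry C l j)"
      unfolding AN by (simp add: sum_distrib_right)
    also have "\<dots> = (\<Sum>k<M. \<Sum>l<N. entry A i k * entry B k l * entry C l j)"
      by (rule sum.swap)
    also have "\<dots> = entry (A * (B * C)) i j"
      unfolding AN BN by (simp add: sum_distrib_left mult.assoc)
    finally show "entry (A * B * C) i j = entry (A * (B * C)) i j" .
  qed
  have S: "entry (A + B) i l \<noteq> 0 \<Longrightarrow> l < max M N" for i l
    using M[of i l] N[of i l] by (cases "entry A i l = 0") (auto simp: plus_finmat.rep_eq)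
  have A': "entry (A * C) i j = (\<Sum>l<max M N. entry A i l * entry C l j)"
   and B': "entry (B * C) i j = (\<Sum>l<max M N. entry B i l * entry C l j)"
   and C': "entry ((A + B) * C) i j = (\<Sum>l<max M N. entry (A + B) i l * entry C l j)" for i j
    by (rule entry_mult; use M N S in fastforce)+
  show "(A + B) * C = A * C + B * C"
    by (rule finmat_eqI) (simp add: A' B' C' plus_finmat.rep_eq sum.distrib algebra_simps)
  show "A * (B + C) = A * B + A * C"
    by (rule finmat_eqI) (simp add: AN plus_finmat.rep_eq sum.distrib algebra_simps)
  have "entry (a *\<^sub>R A) i l \<noteq> 0 \<Longrightarrow> l < M" for i l
    using M by (auto simp: scaleR_finmat.rep_eq)
  then have "entry ((a *\<^sub>R A) * B) i j = (\<Sum>l<M. entry (a *\<^sub>R A) i l * entry B l j)" for i j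
    by (rule entry_mult)
  then show "(a *\<^sub>R A) * B = a *\<^sub>R (A * B)"
    by (intro finmat_eqI) (simp add: AN scaleR_finmat.rep_eq scaleR_sum_right)
  show "A * (a *\<^sub>R B) = a *\<^sub>R (A * B)"
    by (intro finmat_eqI) (simp add: AN scaleR_finmat.rep_eq scaleR_sum_right)
qed

end

lemma entry_simps [simp]:
  "entry 0 i j = 0" "entry (A + B) i j = entry A i j + entry B i j" "entry (- A) i j = - entry A i j"
  "entry (A - B) i j = entry A i j - entry B i j" "entry (c *\<^sub>R A) i j = c *\<^sub>R entry A i j"
  by (simp_all add: zero_finmat.rep_eq plus_finmat.rep_eq uminus_finmat.rep_eq scaleR_finmat.rep_eq
      diff_conv_add_uminus[of A B] del: add_uminus_conv_diff)

lemma entry_sum: "entry (sum f I) i j = (\<Sum>k\<in>I. entry (f k) i j)"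
  by (induction I rule: infinite_finite_induct) auto

lift_definition star :: "finmat \<Rightarrow> finmat" is "\<lambda>f i j. cnj (f j i)"
  by (metis complex_cnj_zero)

lemma entry_star [simp]: "entry (star A) i j = cnj (entry A j i)"
  by (simp add: star.rep_eq)

lemma star_simps [simp]:
  "star (star A) = A" "star 0 = 0" "star (A + B) = star A + star B" "star (- A) = - star A"
  "star (A - B) = star A - star B" "star (c *\<^sub>R A) = c *\<^sub>R star A"
  by (rule finmat_eqI; simp)+

lemma star_sum: "star (sum f I) = (\<Sum>k\<in>I. star (f k))"
  by (induction I rule: infinite_finite_induct) auto

lemma star_mult: "star (A * B) = star B * star A"
proof (rule finmat_eqI)
  fix i j
  obtain M where M: "\<And>i j. entry A i j \<noteq> 0 \<Longrightarrow> i < M \<and> j < M"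
    using entry_bound[of A] by blast
  obtain N where N: "\<And>i j. entry B i j \<noteq> 0 \<Longrightarrow> i < N \<and> j < N"
    using entry_bound[of B] by blast
  have "entry (A * B) j i = (\<Sum>l<max M N. entry A j l * entry B l i)"
    by (rule entry_mult) (use M in fastforce)
  moreover have "entry (star B * star A) i j = (\<Sum>l<max M N. entry (star B) i l * entry (star A) l j)"
    by (rule entry_mult) (use N in fastforce)
  ultimately show "entry (star (A * B)) i j = entry (star B * star A) i j"
    by (simp add: mult.commute)
qed

lemma star_mult_self_diag:
  assumes "\<And>i j. entry A i j \<noteq> 0 \<Longrightarrow> i < N \<and> j < N"
  shows "entry (star A * A) j j = of_real (\<Sum>l<N. (cmod (entry A l j))\<^sup>2)"
proof -
  have "entry (star A * A) j j = (\<Sum>l<N. entry (star A) j l * entry A l j)"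
    by (rule entry_mult) (use assms in auto)
  also have "\<dots> = of_real (\<Sum>l<N. (cmod (entry A l j))\<^sup>2)"
    by (simp add: complex_norm_square mult.commute del: of_real_power)
  finally show ?thesis .
qed

lemma star_mult_self_diag_nonneg: "0 \<le> Re (entry (star A * A) j j)"
proof -
  obtain N where "\<And>i j. entry A i j \<noteq> 0 \<Longrightarrow> i < N \<and> j < N"
    using entry_bound[of A] by blast
  from star_mult_self_diag[of A N, OF this] show ?thesis by (simp add: sum_nonneg)
qed

lemma star_mult_self_diag_eq_0:
  assumes "Re (entry (star A * A) j j) = 0" shows "entry A i j = 0"
proof -
  obtain N where N: "\<And>i j. entry A i j \<noteq> 0 \<Longrightarrow> i < N \<and> j < N"
    using entry_bound[of A] by blast
  have "(\<Sum>l<N. (cmod (entry A l j))\<^sup>2) = 0"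
    using assms star_mult_self_diag[of A N j, OF N] by simp
  then have "i < N \<Longrightarrow> entry A i j = 0"
    by (subst (asm) sum_nonneg_eq_0_iff) auto
  then show "entry A i j = 0" using N by fastforce
qed

lemma star_mult_self_eq_0: "star A * A = 0 \<Longrightarrow> A = 0"
  by (rule finmat_eqI) (simp add: star_mult_self_diag_eq_0)

section \<open>Moore-Penrose inverses in the *-algebra\<close>

definition mp_inverse :: "finmat \<Rightarrow> finmat \<Rightarrow> bool" where
  "mp_inverse A X \<longleftrightarrow> A * X * A = A \<and> X * A * X = X \<and> star (A * X) = A * X \<and> star (X * A) = X * A"

lemma mp_inverse_unique:
  assumes "mp_inverse A X" "mp_inverse A Y" shows "X = Y"
proof -
  note X = assms(1)[unfolded mp_inverse_def] and Y = assms(2)[unfolded mp_inverse_def]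
  have "A * X = (A * Y) * (A * X)" using Y by (metis mult.assoc)
  then have "star (A * X) = star (A * X) * star (A * Y)" by (metis star_mult)
  then have AX: "A * X = A * Y" using X Y by (metis mult.assoc)
  have "X * A = (X * A) * (Y * A)" using Y by (metis mult.assoc)
  then have "star (X * A) = star (Y * A) * star (X * A)" by (metis star_mult)
  then have XA: "X * A = Y * A" using X Y by (metis mult.assoc)
  show ?thesis using AX XA X Y by (metis mult.assoc)
qed

text \<open>An inner inverse \<open>G\<close> of \<open>A\<^sup>3\<close> suffices: since \<open>A * (A * Z) = 0\<close> implies \<open>A * Z = 0\<close> for Hermitian \<open>A\<close>,
factors \<open>A\<close> can be cancelled, which gives \<open>A * G * A\<^sup>3 = A = A\<^sup>3 * G * A\<close>. Hence \<open>E = A * G * A\<^sup>2\<close> is a left unit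
and \<open>F = A\<^sup>2 * G * A\<close> a right unit for \<open>A\<close>. Both turn out to be Hermitian, and they coincide.\<close>

lemma mp_inverse_hermitian:
  assumes A: "star A = A" and G: "A * A * A * G * (A * A * A) = A * A * A"
  shows "mp_inverse A (A * G * A)"
proof -
  define W where "W = A * G * A * A * A - A"
  have AAW: "A * (A * W) = 0"
    using G by (simp add: W_def right_diff_distrib mult.assoc)
  have sW: "star W = A * A * A * star G * A - A" by (simp add: W_def star_mult A mult.assoc)
  have "star (A * W) * (A * W) = star W * (A * (A * W))" by (simp add: star_mult A mult.assoc)
  then have AW: "A * W = 0" by (metis AAW mult_zero_right star_mult_self_eq_0)
  have "star W * W = (A * A * A * star G) * (A * W) - A * W"
    by (simp add: sW left_diff_distrib mult.assoc)
  then have 1: "A * G * A * A * A = A" using AW star_mult_self_eq_0[of W] by (simp add: W_def)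
  define V where "V = star (A * A * A * G * A - A)"
  have sV: "V = A * star G * A * A * A - A" by (simp add: V_def star_mult A mult.assoc)
  have AAV: "A * (A * V) = 0"
    using arg_cong[OF G, of star]
    by (simp add: sV star_mult A right_diff_distrib mult.assoc)
  have "star (A * V) * (A * V) = star V * (A * (A * V))" by (simp add: star_mult A mult.assoc)
  then have AV: "A * V = 0" by (metis AAV mult_zero_right star_mult_self_eq_0)
  have "star V * V = (A * A * A * G) * (A * V) - A * V"
    by (simp add: V_def left_diff_distrib mult.assoc)
  then have "V = 0" using AV star_mult_self_eq_0[of V] by simp
  then have 2: "A * A * A * G * A = A" unfolding V_def by (metis eq_iff_diff_eq_0 star_simps(1,2))
  define E where "E = A * G * A * A"
  define F where "F = A * A * G * A"
  have EA: "E * A = A" and AF: "A * F = A" using 1 2 by (simp_all add: E_def F_def mult.assoc)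
  have "star A = star A * star E" using EA by (metis star_mult)
  then have AE: "A * star E = A" by (simp add: A)
  have "star F * star A = star A" using AF by (metis star_mult)
  then have FA: "star F * A = A" by (simp add: A)
  have "E * star E = E"  unfolding E_def using AE by (simp add: E_def mult.assoc)
  then have Eh: "star E = E" by (metis star_mult star_simps(1))
  have "star F * F = F"  unfolding F_def using FA by (metis F_def mult.assoc)
  then have Fh: "star F = F" by (metis star_mult star_simps(1))
  have "E * F = E" unfolding E_def using AF by (simp add: mult.assoc)
  moreover have "E * F = F" unfolding F_def using EA by (metis mult.assoc)
  ultimately have EF: "E = F" by simp
  have "A * (A * G * A) = F" "A * G * A * A = E" by (simp_all add: E_def F_def mult.assoc)
  then show ?thesis unfolding mp_inverse_def using EA Eh Fh EF
    by (metis (no_types, lifting) mult.assoc)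
qed

section \<open>Supports and the embedding of ordinary matrices\<close>

definition supp :: "nat \<Rightarrow> nat \<Rightarrow> finmat \<Rightarrow> bool" where
  "supp m n A \<longleftrightarrow> (\<forall>i j. entry A i j \<noteq> 0 \<longrightarrow> i < m \<and> j < n)"

lemma suppI: "(\<And>i j. \<not> (i < m \<and> j < n) \<Longrightarrow> entry A i j = 0) \<Longrightarrow> supp m n A"
  by (auto simp: supp_def)

lemma suppD: "supp m n A \<Longrightarrow> \<not> i < m \<or> \<not> j < n \<Longrightarrow> entry A i j = 0"
  by (auto simp: supp_def)

lemma supp_simps [simp]:
  "supp m n 0" "supp m n A \<Longrightarrow> supp m n B \<Longrightarrow> supp m n (A + B)"
  "supp m n A \<Longrightarrow> supp m n (- A)" "supp m n A \<Longrightarrow> supp m n B \<Longrightarrow> supp m n (A - B)"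
  "supp m n A \<Longrightarrow> supp m n (c *\<^sub>R A)" "supp n m (star A) \<longleftrightarrow> supp m n A"
  by (auto simp: supp_def) (metis add.right_neutral diff_zero)+

lemma supp_sum: "(\<And>k. k \<in> I \<Longrightarrow> supp m n (f k)) \<Longrightarrow> supp m n (sum f I)"
  by (induction I rule: infinite_finite_induct) auto

lemma entry_mult_supp: "supp m n A \<Longrightarrow> entry (A * B) i j = (\<Sum>l<n. entry A i l * entry B l j)"
  by (rule entry_mult) (auto simp: supp_def)

lemma entry_mult_supp': "supp m n B \<Longrightarrow> entry (A * B) i j = (\<Sum>l<m. entry A i l * entry B l j)"
proof -
  assume B: "supp m n B"
  obtain N where N: "\<And>i j. entry A i j \<noteq> 0 \<Longrightarrow> i < N \<and> j < N" using entry_bound[of A] by blast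
  have "entry (A * B) i j = (\<Sum>l<max m N. entry A i l * entry B l j)"
    by (rule entry_mult) (use N in fastforce)
  also have "\<dots> = (\<Sum>l<m. entry A i l * entry B l j)"
    by (rule sum.mono_neutral_right) (use B in \<open>auto simp: suppD\<close>)
  finally show ?thesis .
qed

lemma supp_mult [simp]:
  assumes "supp m k A" "supp k' n B" shows "supp m n (A * B)"
proof (rule suppI)
  fix i j assume "\<not> (i < m \<and> j < n)"
  then show "entry (A * B) i j = 0"
    using assms by (subst entry_mult_supp[OF assms(1)]) (auto simp: suppD intro!: sum.neutral)
qed

lemma ex_supp: "\<exists>N. supp N N A"
  by (rule entry_bound[of A]) (auto simp: supp_def)

lemma entry_mult3:
  assumes A: "supp m n A"
  shows "entry (B * A * C) i j = (\<Sum>k<m. \<Sum>l<n. entry B i k * entry A k l * entry C l j)"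
proof -
  obtain N where "supp N N C" using ex_supp by blast
  then have "supp m N (A * C)" using A by (rule supp_mult[rotated])
  then show ?thesis
    by (simp add: mult.assoc entry_mult_supp'[of m N] entry_mult_supp[OF A] sum_distrib_left)
qed

lift_definition eye :: "nat \<Rightarrow> finmat" is "\<lambda>n i j. if i = j \<and> i < n then 1 else 0"
  by (intro exI) auto

lemma entry_eye: "entry (eye n) i j = (if i = j \<and> i < n then 1 else 0)"
  by (simp add: eye.rep_eq)

lemma supp_eye [simp]: "supp n n (eye n)"
  by (auto simp: supp_def entry_eye split: if_splits)

lemma star_eye [simp]: "star (eye n) = eye n"
  by (rule finmat_eqI) (auto simp: entry_eye)

lemma eye_mult: "supp m n A \<Longrightarrow> eye m * A = A"
proof (rule finmat_eqI)
  fix i j assume A: "supp m n A"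
  have "entry (eye m * A) i j = (\<Sum>l<m. if i = l then entry A i j else 0)"
    unfolding entry_mult_supp[OF supp_eye] by (intro sum.cong) (auto simp: entry_eye)
  then show "entry (eye m * A) i j = entry A i j" using A by (auto simp: suppD)
qed

lemma mult_eye: "supp m n A \<Longrightarrow> A * eye n = A"
  by (metis eye_mult star_eye star_mult star_simps(1) supp_simps(6))

lift_definition emb :: "complex mat \<Rightarrow> finmat"
  is "\<lambda>A i j. if i < dim_row A \<and> j < dim_col A then A $$ (i, j) else 0"
proof -
  fix A :: "complex mat"
  show "\<exists>N. \<forall>i j. (if i < dim_row A \<and> j < dim_col A then A $$ (i, j) else 0) \<noteq> 0 \<longrightarrow> i < N \<and> j < N"
    by (intro exI[of _ "max (dim_row A) (dim_col A)"]) auto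
qed

lemma entry_emb: "A \<in> carrier_mat m n \<Longrightarrow> entry (emb A) i j = (if i < m \<and> j < n then A $$ (i, j) else 0)"
  by (auto simp: emb.rep_eq)

lemma supp_emb [simp]: "A \<in> carrier_mat m n \<Longrightarrow> supp m n (emb A)"
  by (auto simp: supp_def entry_emb)

lemma emb_eq_iff: "A \<in> carrier_mat m n \<Longrightarrow> B \<in> carrier_mat m n \<Longrightarrow> emb A = emb B \<longleftrightarrow> A = B"
proof safe
  assume A: "A \<in> carrier_mat m n" "B \<in> carrier_mat m n" and eq: "emb A = emb B"
  show "A = B"
  proof (rule eq_matI)
    fix i j assume "i < dim_row B" "j < dim_col B"
    then have "i < m" "j < n" using A by auto
    then show "A $$ (i, j) = B $$ (i, j)"
      using arg_cong[OF eq, of "\<lambda>X. entry X i j"] A by (simp add: entry_emb)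
  qed (use A in auto)
qed

lemma emb_add: "A \<in> carrier_mat m n \<Longrightarrow> B \<in> carrier_mat m n \<Longrightarrow> emb (A + B) = emb A + emb B"
  by (rule finmat_eqI) (auto simp: entry_emb[of _ m n])

lemma emb_minus: "A \<in> carrier_mat m n \<Longrightarrow> B \<in> carrier_mat m n \<Longrightarrow> emb (A - B) = emb A - emb B"
  by (rule finmat_eqI) (auto simp: emb.rep_eq)

lemma emb_uminus: "emb (- A) = - emb A"
  by (rule finmat_eqI) (auto simp: emb.rep_eq)

lemma emb_smult: "emb (complex_of_real c \<cdot>\<^sub>m A) = c *\<^sub>R emb A"
  by (rule finmat_eqI) (auto simp: emb.rep_eq scaleR_conv_of_real)

lemma emb_0 [simp]: "emb (0\<^sub>m m n) = 0"
  by (rule finmat_eqI) (auto simp: emb.rep_eq)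

lemma emb_mult:
  assumes "A \<in> carrier_mat m k" "B \<in> carrier_mat k n"
  shows "emb (A * B) = emb A * emb B"
proof (rule finmat_eqI)
  fix i j
  have "entry (emb A * emb B) i j = (\<Sum>l<k. entry (emb A) i l * entry (emb B) l j)"
    by (rule entry_mult_supp[OF supp_emb[OF assms(1)]])
  also have "\<dots> = (if i < m \<and> j < n then (A * B) $$ (i, j) else 0)"
    using assms by (auto simp: entry_emb scalar_prod_def lessThan_atLeast0 intro!: sum.cong)
  finally show "entry (emb (A * B)) i j = entry (emb A * emb B) i j"
    using assms by (subst entry_emb[of _ m n]) auto
qed

lemma mat_adjoint_carrier [simp]: "A \<in> carrier_mat m n \<Longrightarrow> mat_adjoint A \<in> carrier_mat n m"
  by (auto simp: mat_adjoint_def)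

lemma emb_adjoint: "emb (mat_adjoint A) = star (emb A)"
  by (rule finmat_eqI) (auto simp: emb.rep_eq mat_adjoint_def mat_of_rows_index)

lemma hermitian_emb: "A \<in> carrier_mat n n \<Longrightarrow> hermitian A \<longleftrightarrow> star (emb A) = emb A"
  by (subst emb_adjoint[symmetric], subst emb_eq_iff[of _ n n]) (auto simp: hermitian_def)

section \<open>Positivity\<close>

text \<open>The test vectors \<open>x\<close> are elements of the algebra, of which only column \<open>0\<close> enters. Since \<open>psd\<close> has
no dimension, congruence by rectangular factors preserves it for free. Definiteness needs the dimension.\<close>

definition psd :: "finmat \<Rightarrow> bool" where
  "psd M \<longleftrightarrow> star M = M \<and> (\<forall>x. 0 \<le> entry (star x * M * x) 0 0)"

definition pd :: "nat \<Rightarrow> finmat \<Rightarrow> bool" where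
  "pd n M \<longleftrightarrow> star M = M \<and> (\<forall>x. supp n 1 x \<longrightarrow> x \<noteq> 0 \<longrightarrow> 0 < entry (star x * M * x) 0 0)"

lemma quadratic_form_emb:
  assumes A: "A \<in> carrier_mat n n"
  shows "entry (star x * emb A * x) 0 0 = (A *\<^sub>v vec n (\<lambda>i. entry x i 0)) \<bullet>c vec n (\<lambda>i. entry x i 0)"
proof -
  have "entry (star x * emb A * x) 0 0 = (\<Sum>i<n. \<Sum>j<n. cnj (entry x i 0) * A $$ (i, j) * entry x j 0)"
    using A by (subst entry_mult3[OF supp_emb[OF A]]) (auto simp: entry_emb[OF A] intro!: sum.cong)
  also have "\<dots> = (A *\<^sub>v vec n (\<lambda>i. entry x i 0)) \<bullet>c vec n (\<lambda>i. entry x i 0)"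
    using A by (auto simp: scalar_prod_def lessThan_atLeast0 sum_distrib_left sum_distrib_right mult_ac intro!: sum.cong)
  finally show ?thesis .
qed

lift_definition col_of :: "complex vec \<Rightarrow> finmat" is "\<lambda>v i j. if i < dim_vec v \<and> j = 0 then v $ i else 0"
proof -
  fix v :: "complex vec"
  show "\<exists>N. \<forall>i j. (if i < dim_vec v \<and> j = 0 then v $ i else 0) \<noteq> 0 \<longrightarrow> i < N \<and> j < N"
    by (intro exI[of _ "Suc (dim_vec v)"]) auto
qed

lemma vec_col_of: "v \<in> carrier_vec n \<Longrightarrow> vec n (\<lambda>i. entry (col_of v) i 0) = v"
  by (rule eq_vecI) (auto simp: col_of.rep_eq)

lemma supp_col_of: "v \<in> carrier_vec n \<Longrightarrow> supp n 1 (col_of v)"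
  by (auto simp: supp_def col_of.rep_eq split: if_splits)

lemma nonneg_hermitian_emb:
  assumes A: "A \<in> carrier_mat n n"
  shows "nonneg_hermitian A \<longleftrightarrow> psd (emb A)"
proof -
  have "(\<forall>v\<in>carrier_vec n. 0 \<le> (A *\<^sub>v v) \<bullet>c v) \<longleftrightarrow> (\<forall>x. 0 \<le> entry (star x * emb A * x) 0 0)"
    unfolding quadratic_form_emb[OF A] by (metis vec_carrier vec_col_of)
  then show ?thesis
    using A by (auto simp: nonneg_hermitian_def psd_def hermitian_emb[OF A])
qed

lemma pos_hermitian_emb:
  assumes A: "A \<in> carrier_mat n n"
  shows "pos_hermitian A \<longleftrightarrow> pd n (emb A)"
proof -
  have "(\<forall>v\<in>carrier_vec n. v \<noteq> 0\<^sub>v n \<longrightarrow> 0 < (A *\<^sub>v v) \<bullet>c v) \<longleftrightarrow>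
    (\<forall>x. supp n 1 x \<longrightarrow> x \<noteq> 0 \<longrightarrow> 0 < entry (star x * emb A * x) 0 0)" (is "?L = ?R")
  proof
    assume L: ?L
    show ?R
    proof (intro allI impI)
      fix x assume x: "supp n 1 x" "x \<noteq> 0"
      have "vec n (\<lambda>i. entry x i 0) \<noteq> 0\<^sub>v n"
      proof
        assume *: "vec n (\<lambda>i. entry x i 0) = 0\<^sub>v n"
        have "entry x i 0 = 0" if "i < n" for i
          using arg_cong[OF *, of "\<lambda>v. v $ i"] that by simp
        then have "x = 0"
          using x(1) by (intro finmat_eqI) (metis entry_simps(1) less_one supp_def)
        with x(2) show False ..
      qed
      then show "0 < entry (star x * emb A * x) 0 0"
        unfolding quadratic_form_emb[OF A] using L by simp
    qed
  next
    assume R: ?R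
    show ?L
    proof (intro ballI impI)
      fix v :: "complex vec" assume v: "v \<in> carrier_vec n" "v \<noteq> 0\<^sub>v n"
      have "col_of v \<noteq> 0"
      proof
        assume "col_of v = 0"
        then have "v = 0\<^sub>v n" using vec_col_of[OF v(1)] by auto
        with v(2) show False ..
      qed
      then have "0 < entry (star (col_of v) * emb A * col_of v) 0 0"
        using R supp_col_of[OF v(1)] by blast
      then show "0 < (A *\<^sub>v v) \<bullet>c v"
        unfolding quadratic_form_emb[OF A] vec_col_of[OF v(1)] .
    qed
  qed
  then show ?thesis
    using A by (auto simp: pos_hermitian_def pd_def hermitian_emb[OF A])
qed

lemma psd_congruence:
  assumes "psd M" shows "psd (B * M * star B)"
proof -
  have "0 \<le> entry (star x * (B * M * star B) * x) 0 0" for x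
  proof -
    have "star x * (B * M * star B) * x = star (star B * x) * M * (star B * x)"
      by (simp add: star_mult mult.assoc)
    then show ?thesis using assms by (simp add: psd_def)
  qed
  moreover have "star (B * M * star B) = B * M * star B"
    using assms by (simp add: psd_def star_mult mult.assoc)
  ultimately show ?thesis by (simp add: psd_def)
qed

lemma pd_congruence:
  assumes M: "pd n M" and C: "C * star B = eye k" and B: "supp k n B"
  shows "pd k (B * M * star B)"
proof -
  have "0 < entry (star x * (B * M * star B) * x) 0 0" if x: "supp k 1 x" "x \<noteq> 0" for x
  proof -
    have *: "star x * (B * M * star B) * x = star (star B * x) * M * (star B * x)"
      by (simp add: star_mult mult.assoc)
    have "C * (star B * x) = x"
      using C eye_mult[OF x(1)] by (simp add: mult.assoc[symmetric])
    then have "star B * x \<noteq> 0" using x(2) by force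
    moreover have "supp n 1 (star B * x)" using B x by (metis supp_mult supp_simps(6))
    ultimately show ?thesis unfolding * using M by (simp add: pd_def)
  qed
  moreover have "star (B * M * star B) = B * M * star B"
    using M by (simp add: pd_def star_mult mult.assoc)
  ultimately show ?thesis by (simp add: pd_def)
qed

text \<open>Multiplication by these columns extracts columns of a matrix, and so turns statements about single
vectors into statements about all columns at once.\<close>

definition unit_col :: "nat \<Rightarrow> finmat" where
  "unit_col j = col_of (unit_vec (Suc j) j)"

lemma entry_unit_col: "entry (unit_col j) i k = (if i = j \<and> k = 0 then 1 else 0)"
  by (auto simp: unit_col_def col_of.rep_eq)

lemma supp_unit_col: "supp (Suc j) 1 (unit_col j)"
  by (auto simp: supp_def entry_unit_col split: if_splits)

lemma entry_mult_unit_col: "entry (Z * unit_col j) i 0 = entry Z i j"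
  by (simp add: entry_mult_supp'[OF supp_unit_col] entry_unit_col if_distrib[of "\<lambda>x. _ * x"] cong: if_cong)

lemma entry_star_unit_col_mult: "entry (star (unit_col j) * Z) 0 k = entry Z j k"
proof -
  have "star (unit_col j) * Z = star (star Z * unit_col j)" by (simp add: star_mult)
  then show ?thesis by (simp add: entry_mult_unit_col)
qed

lemma psd_diag:
  assumes "psd M" shows "0 \<le> entry (star X * M * X) j j"
proof -
  have "star (X * unit_col j) * M * (X * unit_col j) = star (unit_col j) * ((star X * M * X) * unit_col j)"
    by (simp add: star_mult mult.assoc)
  then have "entry (star (X * unit_col j) * M * (X * unit_col j)) 0 0 = entry (star X * M * X) j j"
    by (simp add: entry_star_unit_col_mult entry_mult_unit_col)
  then show ?thesis using assms by (metis psd_def)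
qed

lemma pd_kernel:
  assumes M: "pd n M" and X: "supp n k X" "M * X = 0"
  shows "X = 0"
proof (rule finmat_eqI)
  fix i j
  have "star (X * unit_col j) * M * (X * unit_col j) = star (X * unit_col j) * ((M * X) * unit_col j)"
    by (simp add: mult.assoc)
  then have "entry (star (X * unit_col j) * M * (X * unit_col j)) 0 0 = 0" using X(2) by simp
  moreover have "supp n 1 (X * unit_col j)" using X(1) supp_unit_col by (rule supp_mult)
  ultimately have "X * unit_col j = 0" using M unfolding pd_def by force
  then show "entry X i j = entry 0 i j" using entry_mult_unit_col[of X j i] by simp
qed

text \<open>For a nonnegative form, isotropic vectors lie in the kernel: on \<open>X - t * M * X\<close> the form is
\<open>- 2 * t * N + t\<^sup>2 * R\<close> with \<open>N\<close> the squared norm of (a column of) \<open>M * X\<close>, and this is negative for small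
\<open>t > 0\<close> unless \<open>N = 0\<close>.\<close>

lemma psd_kernel:
  assumes M: "psd M" and X: "star X * M * X = 0"
  shows "M * X = 0"
proof (rule finmat_eqI)
  fix i j
  define N where "N = Re (entry (star (M * X) * (M * X)) j j)"
  define R where "R = Re (entry (star (M * X) * M * (M * X)) j j)"
  have N0: "0 \<le> N" unfolding N_def by (rule star_mult_self_diag_nonneg)
  have sM: "star M = M" using M by (simp add: psd_def)
  have "0 \<le> - (2 * t * N) + t * t * R" for t :: real
  proof -
    define Y where "Y = X - t *\<^sub>R (M * X)"
    have X': "star X * (M * X) = 0" using X by (simp add: mult.assoc)
    have "star Y * M * Y = - (2 * t) *\<^sub>R (star (M * X) * (M * X)) + (t * t) *\<^sub>R (star (M * X) * M * (M * X))"
      by (simp add: Y_def star_mult sM algebra_simps X' scaleR_2[symmetric])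
    then have "Re (entry (star Y * M * Y) j j) = - (2 * t * N) + t * t * R"
      by (simp add: N_def R_def)
    moreover have "0 \<le> Re (entry (star Y * M * Y) j j)"
      using psd_diag[OF M, of Y j] by (simp add: less_eq_complex_def)
    ultimately show ?thesis by simp
  qed
  note ineq = this
  have "N = 0"
  proof (rule ccontr)
    assume "N \<noteq> 0"
    then have N: "N > 0" using N0 by simp
    \<comment> \<open>small enough that the quadratic term cannot compensate the linear one\<close>
    define t where "t = N / (\<bar>R\<bar> + 1)"
    have t: "t > 0" using N by (simp add: t_def)
    have "t * R \<le> t * \<bar>R\<bar>" using t by (intro mult_left_mono) auto
    also have "\<dots> \<le> N" unfolding t_def using N by (simp add: field_simps)
    finally have "t * R \<le> N" .
    then have "t * (- 2 * N + t * R) < 0" using t N by (intro mult_pos_neg) auto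
    then show False using ineq[of t] by (simp add: algebra_simps)
  qed
  then show "entry (M * X) i j = entry 0 i j"
    using star_mult_self_diag_eq_0[of "M * X" j i] by (simp add: N_def)
qed

section \<open>Block matrices\<close>

lift_definition blk :: "nat \<Rightarrow> nat \<Rightarrow> nat \<Rightarrow> (nat \<Rightarrow> nat \<Rightarrow> finmat) \<Rightarrow> finmat"
  is "\<lambda>q m n F i k. if i < m * q \<and> k < n * q then entry (F (i div q) (k div q)) (i mod q) (k mod q) else 0"
proof -
  fix q m n and F :: "nat \<Rightarrow> nat \<Rightarrow> finmat"
  show "\<exists>N. \<forall>i k. (if i < m * q \<and> k < n * q then entry (F (i div q) (k div q)) (i mod q) (k mod q) else 0) \<noteq> 0
    \<longrightarrow> i < N \<and> k < N"
    by (intro exI[of _ "max (m * q) (n * q)"]) auto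
qed

lemma supp_blk [simp]: "supp (m * q) (n * q) (blk q m n F)"
  by (auto simp: supp_def blk.rep_eq split: if_splits)

lemma star_blk: "star (blk q m n F) = blk q n m (\<lambda>j k. star (F k j))"
  by (rule finmat_eqI) (auto simp: blk.rep_eq)

lemma blk_cong:
  assumes "\<And>j k. j < m \<Longrightarrow> k < n \<Longrightarrow> F j k = G j k" shows "blk q m n F = blk q m n G"
  by (rule finmat_eqI) (auto simp: blk.rep_eq assms less_mult_imp_div_less)

lemma sum_blocks:
  fixes f :: "nat \<Rightarrow> 'a::comm_monoid_add"
  shows "(\<Sum>i<n * q. f i) = (\<Sum>l<n. \<Sum>r<q. f (l * q + r))"
proof (induction n)
  case (Suc n)
  have "(\<Sum>i<Suc n * q. f i) = (\<Sum>i<n * q. f i) + (\<Sum>i=n * q..<n * q + q. f i)"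
    by (simp add: lessThan_atLeast0 sum.atLeastLessThan_concat add.commute)
  also have "(\<Sum>i=n * q..<n * q + q. f i) = (\<Sum>r<q. f (n * q + r))"
    using sum.shift_bounds_nat_ivl[of f 0 "n * q" q] by (simp add: lessThan_atLeast0 add.commute)
  finally show ?case using Suc by simp
qed simp

lemma blk_mult:
  assumes q: "q > 0" and F: "\<And>j l. j < m \<Longrightarrow> l < p \<Longrightarrow> supp q q (F j l)"
  shows "blk q m p F * blk q p n G = blk q m n (\<lambda>j k. \<Sum>l<p. F j l * G l k)"
proof (rule finmat_eqI)
  fix i k
  have "entry (blk q m p F * blk q p n G) i k = (\<Sum>l<p. \<Sum>r<q. entry (blk q m p F) i (l * q + r) * entry (blk q p n G) (l * q + r) k)"
    unfolding entry_mult_supp[OF supp_blk] by (rule sum_blocks)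
  also have "\<dots> = entry (blk q m n (\<lambda>j k. \<Sum>l<p. F j l * G l k)) i k"
  proof (cases "i < m * q \<and> k < n * q")
    case True
    have lt: "l * q + r < p * q" if "l < p" "r < q" for l r
    proof -
      have "l * q + r < Suc l * q" using that by simp
      also have "\<dots> \<le> p * q" using that by (intro mult_le_mono1) simp
      finally show ?thesis .
    qed
    have "i div q < m" using True by (auto simp: less_mult_imp_div_less)
    then have "entry (F (i div q) l * G l (k div q)) (i mod q) (k mod q) =
      (\<Sum>r<q. entry (F (i div q) l) (i mod q) r * entry (G l (k div q)) r (k mod q))" if "l < p" for l
      using F that by (intro entry_mult_supp[of q]) auto
    then show ?thesis using True q lt by (simp add: blk.rep_eq entry_sum)
  next
    case False
    then show ?thesis by (auto simp: blk.rep_eq)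
  qed
  finally show "entry (blk q m p F * blk q p n G) i k = entry (blk q m n (\<lambda>j k. \<Sum>l<p. F j l * G l k)) i k" .
qed

lemma blk_eqD:
  assumes eq: "blk q m n F = blk q m n G" and jk: "j < m" "k < n"
    and F: "supp q q (F j k)" and G: "supp q q (G j k)"
  shows "F j k = G j k"
proof (rule finmat_eqI)
  fix a b
  show "entry (F j k) a b = entry (G j k) a b"
  proof (cases "a < q \<and> b < q")
    case True
    have "j * q + a < Suc j * q" "k * q + b < Suc k * q" using True by auto
    also have "Suc j * q \<le> m * q" "Suc k * q \<le> n * q" using jk by (intro mult_le_mono1; simp)+
    ultimately have "j * q + a < m * q" "k * q + b < n * q"
      by (meson less_le_trans mult_le_mono1 Suc_leI jk)+
    then show ?thesis
      using arg_cong[OF eq, of "\<lambda>X. entry X (j * q + a) (k * q + b)"] True by (simp add: blk.rep_eq)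
  qed (use F G in \<open>auto simp: suppD\<close>)
qed

lemma blk_0: "blk q m n (\<lambda>_ _. 0) = 0"
  by (rule finmat_eqI) (simp add: blk.rep_eq)

lemma blk_eq_0_iff:
  assumes "\<And>j k. j < m \<Longrightarrow> k < n \<Longrightarrow> supp q q (F j k)"
  shows "blk q m n F = 0 \<longleftrightarrow> (\<forall>j<m. \<forall>k<n. F j k = 0)"
  using blk_eqD[of q m n F "\<lambda>_ _. 0"] assms blk_cong[of m n F "\<lambda>_ _. 0" q]
  by (auto simp: blk_0)

lemma blk_eye: "q > 0 \<Longrightarrow> blk q n n (\<lambda>j k. if j = k then eye q else 0) = eye (n * q)"
proof (rule finmat_eqI)
  fix i k assume q: "q > 0"
  have "i = k \<longleftrightarrow> i div q = k div q \<and> i mod q = k mod q" by (metis div_mult_mod_eq)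
  then show "entry (blk q n n (\<lambda>j k. if j = k then eye q else 0)) i k = entry (eye (n * q)) i k"
    using q by (auto simp: blk.rep_eq entry_eye)
qed

lemma blk_column_surj:
  assumes q: "q > 0" and Z: "supp (n * q) q Z"
  obtains Y where "Z = blk q n 1 (\<lambda>b _. Y b)" "\<And>b. supp q q (Y b)"
proof
  define Y where "Y b = emb (mat q q (\<lambda>(i, k). entry Z (b * q + i) k))" for b
  show "supp q q (Y b)" for b unfolding Y_def by (rule supp_emb) simp
  show "Z = blk q n 1 (\<lambda>b _. Y b)"
    using q Z by (intro finmat_eqI) (auto simp: blk.rep_eq Y_def emb.rep_eq suppD)
qed

section \<open>Existence of Moore-Penrose inverses\<close>

text \<open>With an invertible \<open>P\<close>, Gauss-Jordan elimination gives a row echelon form \<open>R = P * A\<close>. The 0-1 matrix that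
sends the row of a pivot to its column is an inner inverse of \<open>R\<close>, because the pivot columns of \<open>R\<close>
are unit vectors. Multiplication by \<open>P\<close> turns it into an inner inverse of \<open>A\<close>.\<close>

lemma ex_inner_inverse:
  fixes A :: "complex mat"
  assumes A: "A \<in> carrier_mat n m"
  obtains G where "G \<in> carrier_mat m n" "emb A * emb G * emb A = emb A"
proof -
  define R where "R = gauss_jordan_single A"
  note gj = gauss_jordan_single[OF A, of R]
  obtain P Q where PQ: "R = P * A" "P \<in> carrier_mat n n" "Q \<in> carrier_mat n n" "Q * P = 1\<^sub>m n"
    using gj(4) R_def by auto
  have R: "R \<in> carrier_mat n m" using gj(2) R_def by auto
  obtain f where f: "pivot_fun R f m"
    using gj(3) R R_def by (auto simp: row_echelon_form_def)
  have pf: "\<And>i. i < n \<Longrightarrow> f i \<le> m" "\<And>i j. i < n \<Longrightarrow> j < f i \<Longrightarrow> R $$ (i, j) = 0"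
    "\<And>i. i < n \<Longrightarrow> f i < m \<Longrightarrow> R $$ (i, f i) = 1"
    "\<And>i k. i < n \<Longrightarrow> f i < m \<Longrightarrow> k < n \<Longrightarrow> k \<noteq> i \<Longrightarrow> R $$ (k, f i) = 0"
    using pivot_funD[OF _ f, of n] R by auto
  define G where "G = mat m n (\<lambda>(j, i). if f i = j then 1 else 0 :: complex)"
  have G: "G \<in> carrier_mat m n" by (simp add: G_def)
  have RG: "entry (emb R * emb G) k i = (if f i < m \<and> k = i then 1 else 0)" if "k < n" "i < n" for k i
  proof -
    have "entry (emb R * emb G) k i = (\<Sum>j<m. if f i = j then R $$ (k, j) else 0)"
      unfolding entry_mult_supp[OF supp_emb[OF R]]
      using that by (intro sum.cong) (auto simp: entry_emb[OF R] entry_emb[OF G], auto simp: G_def)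
    then show ?thesis using that pf by auto
  qed
  have "emb R * emb G * emb R = emb R"
  proof (rule finmat_eqI)
    fix k j
    have RGR: "entry (emb R * emb G * emb R) k j = (\<Sum>i<n. entry (emb R * emb G) k i * entry (emb R) i j)"
      by (rule entry_mult_supp[OF supp_mult[OF supp_emb[OF R] supp_emb[OF G]]])
    show "entry (emb R * emb G * emb R) k j = entry (emb R) k j"
    proof (cases "k < n \<and> j < m")
      case True
      then have "(\<Sum>i<n. entry (emb R * emb G) k i * entry (emb R) i j)
        = (\<Sum>i<n. if k = i then (if f k < m then R $$ (k, j) else 0) else 0)"
        by (intro sum.cong) (auto simp: RG entry_emb[OF R])
      also have "\<dots> = entry (emb R) k j"
        using pf(1)[of k] pf(2)[of k j] True by (cases "f k = m") (auto simp: entry_emb[OF R])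
      finally show ?thesis using RGR by simp
    next
      case False
      have "supp n m (emb R * emb G * emb R)"
        by (rule supp_mult[OF supp_mult[OF supp_emb[OF R] supp_emb[OF G]] supp_emb[OF R]])
      then show ?thesis using False R by (auto simp: suppD entry_emb)
    qed
  qed
  moreover have PA: "emb P * emb A = emb R" using PQ A by (simp add: emb_mult)
  moreover have "emb Q * emb R = emb A"
  proof -
    have "emb Q * emb R = emb (Q * P) * emb A"
      by (simp add: PA[symmetric] emb_mult[OF PQ(3,2)] mult.assoc)
    also have "\<dots> = emb (1\<^sub>m n * A)" unfolding PQ(4) by (rule emb_mult[symmetric]) (use A in auto)
    finally show ?thesis using A by simp
  qed
  ultimately have "emb A * (emb G * emb P) * emb A = emb A"
    by (metis mult.assoc)
  then have "emb A * emb (G * P) * emb A = emb A"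
    using G PQ by (simp add: emb_mult)
  with that[of "G * P"] G PQ show ?thesis by auto
qed

lemma is_moore_penrose_emb:
  assumes A: "A \<in> carrier_mat n n" and X: "X \<in> carrier_mat n n"
  shows "is_moore_penrose A X \<longleftrightarrow> mp_inverse (emb A) (emb X)"
proof -
  have c: "A * X \<in> carrier_mat n n" "X * A \<in> carrier_mat n n" "A * X * A \<in> carrier_mat n n" "X * A * X \<in> carrier_mat n n"
    using A X by auto
  have 1: "A * X * A = A \<longleftrightarrow> emb A * emb X * emb A = emb A"
    using A X c by (metis emb_eq_iff emb_mult)
  have 2: "X * A * X = X \<longleftrightarrow> emb X * emb A * emb X = emb X"
    using A X c by (metis emb_eq_iff emb_mult)
  have 3: "mat_adjoint (A * X) = A * X \<longleftrightarrow> star (emb A * emb X) = emb A * emb X"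
    using A X c by (metis emb_eq_iff emb_mult emb_adjoint mat_adjoint_carrier)
  have 4: "mat_adjoint (X * A) = X * A \<longleftrightarrow> star (emb X * emb A) = emb X * emb A"
    using A X c by (metis emb_eq_iff emb_mult emb_adjoint mat_adjoint_carrier)
  show ?thesis using A X by (auto simp only: is_moore_penrose_def mp_inverse_def 1 2 3 4 carrier_matD)
qed

lemma moore_penrose_hermitian:
  assumes A: "A \<in> carrier_mat n n" and h: "star (emb A) = emb A"
  shows "moore_penrose A \<in> carrier_mat n n \<and> mp_inverse (emb A) (emb (moore_penrose A))"
proof -
  obtain G where G: "G \<in> carrier_mat n n" "emb (A * A * A) * emb G * emb (A * A * A) = emb (A * A * A)"
    using ex_inner_inverse[of "A * A * A" n n] A by auto
  define X where "X = A * G * A"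
  have X: "X \<in> carrier_mat n n" using A G by (simp add: X_def)
  have "emb (A * A * A) = emb A * emb A * emb A" "emb X = emb A * emb G * emb A"
    unfolding X_def using A G(1) by (metis emb_mult mult_carrier_mat)+
  then have "mp_inverse (emb A) (emb X)"
    using mp_inverse_hermitian[OF h, of "emb G"] G(2) by simp
  then have mpX: "is_moore_penrose A X" using is_moore_penrose_emb[OF A X] by simp
  have "Y = X" if Y: "is_moore_penrose A Y" for Y
  proof -
    have Yc: "Y \<in> carrier_mat n n" using Y A by (auto simp: is_moore_penrose_def)
    show ?thesis
      using mp_inverse_unique[of "emb A" "emb Y" "emb X"] Y mpX
      by (simp add: is_moore_penrose_emb[OF A X] is_moore_penrose_emb[OF A Yc] emb_eq_iff[OF Yc X])
  qed
  with mpX have "moore_penrose A = X"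
    unfolding moore_penrose_def by blast
  then show ?thesis using X mpX is_moore_penrose_emb[OF A X] by simp
qed

lemma mp_inverse_hermitian_commute:
  assumes A: "star A = A" and X: "mp_inverse A X"
  shows "star X = X" "A * X = X * A"
proof -
  note x = X[unfolded mp_inverse_def]
  have "mp_inverse A (star X)"
    unfolding mp_inverse_def using x A by (metis mult.assoc star_mult star_simps(1))
  then show "star X = X" using X mp_inverse_unique by blast
  then show "A * X = X * A" using x A by (metis star_mult)
qed

section \<open>Block Hankel matrices and Schur complements\<close>

definition hankel :: "nat \<Rightarrow> (nat \<Rightarrow> finmat) \<Rightarrow> nat \<Rightarrow> finmat" where
  "hankel q v n = blk q (Suc n) (Suc n) (\<lambda>j k. v (j + k))"

definition blkcol :: "nat \<Rightarrow> nat \<Rightarrow> (nat \<Rightarrow> finmat) \<Rightarrow> finmat" where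
  "blkcol q n Y = blk q n 1 (\<lambda>b _. Y b)"

lemma emb_block_hankel:
  assumes "q > 0" "\<And>j. j \<le> 2 * n \<Longrightarrow> s j \<in> carrier_mat q q"
  shows "emb (block_hankel q s n) = hankel q (\<lambda>j. emb (s j)) n"
proof (rule finmat_eqI)
  fix i k
  have "i div q < Suc n \<and> k div q < Suc n" if "i < Suc n * q" "k < Suc n * q"
    using that less_mult_imp_div_less by blast
  then show "entry (emb (block_hankel q s n)) i k = entry (hankel q (\<lambda>j. emb (s j)) n) i k"
    using assms by (auto simp: hankel_def block_hankel_def blk.rep_eq emb.rep_eq)
      (metis add_mono carrier_matD less_Suc_eq_le mod_less_divisor mult_2)+
qed

lemma block_hankel_carrier: "block_hankel q s n \<in> carrier_mat (Suc n * q) (Suc n * q)"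
  by (simp add: block_hankel_def)

lemma hankel_hermitian_iff:
  assumes "\<And>j. j \<le> 2 * n \<Longrightarrow> supp q q (v j)"
  shows "star (hankel q v n) = hankel q v n \<longleftrightarrow> (\<forall>j\<le>2*n. star (v j) = v j)"
proof
  assume H: "star (hankel q v n) = hankel q v n"
  show "\<forall>j\<le>2*n. star (v j) = v j"
  proof (intro allI impI)
    fix j assume j: "j \<le> 2 * n"
    define a where "a = min j n"
    have a: "a < Suc n" "j - a < Suc n" "a + (j - a) = j" using j by (auto simp: a_def)
    have "star (v (j - a + a)) = v (a + (j - a))"
      using H a assms j unfolding hankel_def star_blk
      by (intro blk_eqD[of q "Suc n" "Suc n" "\<lambda>j k. star (v (k + j))" "\<lambda>j k. v (j + k)"]) auto
    then show "star (v j) = v j" using a by simp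
  qed
next
  assume "\<forall>j\<le>2*n. star (v j) = v j"
  then show "star (hankel q v n) = hankel q v n"
    unfolding hankel_def star_blk by (intro blk_cong) (auto simp: add.commute)
qed

lemma hankel_blkcol:
  assumes "q > 0" "\<And>j. j \<le> 2 * n \<Longrightarrow> supp q q (v j)"
  shows "hankel q v n * blkcol q (Suc n) Y = blkcol q (Suc n) (\<lambda>a. \<Sum>b\<le>n. v (a + b) * Y b)"
  unfolding hankel_def blkcol_def using assms
  by (subst blk_mult) (auto simp: lessThan_Suc_atMost)

lemma blkcol_star_mult:
  assumes "q > 0" "\<And>b. b < n \<Longrightarrow> supp q q (Y b)"
  shows "star (blkcol q n Y) * blkcol q n Z = blk q 1 1 (\<lambda>_ _. \<Sum>b<n. star (Y b) * Z b)"
  unfolding blkcol_def star_blk using assms by (subst blk_mult) auto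

lemma blkcol_eq_0_iff:
  "(\<And>b. b < n \<Longrightarrow> supp q q (Y b)) \<Longrightarrow> blkcol q n Y = 0 \<longleftrightarrow> (\<forall>b<n. Y b = 0)"
  unfolding blkcol_def by (subst blk_eq_0_iff) auto

text \<open>The block form in which nonnegativity is used: a block column annihilated by the quadratic form is
annihilated by the matrix.\<close>

lemma hankel_kernel:
  assumes q: "q > 0" and v: "\<And>j. j \<le> 2 * n \<Longrightarrow> supp q q (v j)" and psd: "psd (hankel q v n)"
    and Y: "\<And>b. b \<le> n \<Longrightarrow> supp q q (Y b)"
    and 0: "(\<Sum>a\<le>n. star (Y a) * (\<Sum>b\<le>n. v (a + b) * Y b)) = 0" and a: "a \<le> n"
  shows "(\<Sum>b\<le>n. v (a + b) * Y b) = 0"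
proof -
  have "star (blkcol q (Suc n) Y) * hankel q v n * blkcol q (Suc n) Y = 0"
    using Y 0 by (simp add: mult.assoc hankel_blkcol[OF q v] blkcol_star_mult[OF q]
        lessThan_Suc_atMost blk_0)
  then have "hankel q v n * blkcol q (Suc n) Y = 0" by (rule psd_kernel[OF psd])
  moreover have "supp q q (\<Sum>b\<le>n. v (a + b) * Y b)" if "a \<le> n" for a
    using that v Y by (intro supp_sum supp_mult[of q q _ q q]) auto
  ultimately show ?thesis
    using a by (simp add: hankel_blkcol[OF q v] blkcol_eq_0_iff less_Suc_eq_le)
qed

text \<open>The kernel of the first entry is contained in the kernels of the later ones, except possibly the last.
If \<open>v (2 * a) * X = 0\<close>, then the block column with \<open>X\<close> in slot \<open>a\<close> is isotropic, so \<open>v (a + b) * X = 0\<close> for all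
\<open>b \<le> n\<close>. Every index \<open>0 < j < 2 * n\<close> is of the form \<open>a + b\<close> with \<open>2 * a < j\<close> and \<open>b \<le> n\<close>; the index \<open>2 * n\<close>
would need \<open>a = b = n\<close>.\<close>

lemma hankel_range:
  assumes q: "q > 0" and v: "\<And>j. j \<le> 2 * n \<Longrightarrow> supp q q (v j)" and psd: "psd (hankel q v n)"
    and X: "supp q q X" "v 0 * X = 0" and j: "j < 2 * n"
  shows "v j * X = 0"
  using j
proof (induction j rule: less_induct)
  case (less j)
  show ?case
  proof (cases "j = 0")
    case False
    define a where "a = (j - 1) div 2"
    have a: "2 * a < j" "a \<le> n" "j - a \<le> n" "j - a + a = j" using False less.prems by (auto simp: a_def)
    have v2a: "v (2 * a) * X = 0" using less a by auto
    define Y where "Y b = (if b = a then X else 0)" for b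
    have YX: "(\<Sum>b\<le>n. v (c + b) * Y b) = v (c + a) * X" for c
      using a(2) by (simp add: Y_def if_distrib[of "\<lambda>x. _ * x"] cong: if_cong)
    have "(\<Sum>b\<le>n. v (j - a + b) * Y b) = 0"
    proof (rule hankel_kernel[OF q v psd])
      show "(\<Sum>c\<le>n. star (Y c) * (\<Sum>b\<le>n. v (c + b) * Y b)) = 0"
        unfolding YX using v2a by (intro sum.neutral) (auto simp: Y_def mult_2)
    qed (use X a in \<open>auto simp: Y_def\<close>)
    then show ?thesis unfolding YX a by simp
  qed (use X in simp)
qed

text \<open>The Schur complement of the upper left block of a nonnegative block Hankel matrix vanishes iff the
kernel of the whole matrix contains a block column that ends in the identity. This description no longer
mentions the Moore-Penrose inverse and can be transported through congruences. The column is
\<open>- K' * y\<close>, completed by the identity; that it works depends on \<open>K * K' * y = y\<close>, which is where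
nonnegativity enters.\<close>

lemma schur_complement_eq_0_iff:
  assumes q: "q > 0" and v: "\<And>j. j \<le> 2 * Suc m \<Longrightarrow> supp q q (v j)" and psd: "psd (hankel q v (Suc m))"
    and K': "mp_inverse (hankel q v m) K'"
  defines "y \<equiv> blkcol q (Suc m) (\<lambda>j. v (Suc m + j))"
  shows "blk q 1 1 (\<lambda>_ _. v (2 * Suc m)) - star y * K' * y = 0 \<longleftrightarrow>
    (\<exists>Y. (\<forall>b. supp q q (Y b)) \<and> Y (Suc m) = eye q \<and> (\<forall>a\<le>Suc m. (\<Sum>b\<le>Suc m. v (a + b) * Y b) = 0))"
    (is "?L \<longleftrightarrow> ?R")
proof -
  define K where "K = hankel q v m"
  have v': "j \<le> 2 * m \<Longrightarrow> supp q q (v j)" for j using v by simp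
  have sv: "star (v j) = v j" if "j \<le> 2 * Suc m" for j
    using hankel_hermitian_iff[of "Suc m" q v] v psd that by (auto simp: psd_def)
  have sK: "star K = K"
    unfolding K_def using hankel_hermitian_iff[of m q v] v sv by auto
  note K'K = K'[folded K_def, unfolded mp_inverse_def]
  note comm = mp_inverse_hermitian_commute[OF sK K'[folded K_def]]
  have Kcol: "K * blkcol q (Suc m) Y = blkcol q (Suc m) (\<lambda>a. \<Sum>b\<le>m. v (a + b) * Y b)" for Y
    unfolding K_def by (rule hankel_blkcol[OF q v']) auto
  have ycol: "star y * blkcol q (Suc m) Y = blk q 1 1 (\<lambda>_ _. \<Sum>b\<le>m. v (Suc m + b) * Y b)" for Y
    unfolding y_def using v sv by (subst blkcol_star_mult[OF q])
      (auto simp: lessThan_Suc_atMost intro!: blk_cong sum.cong)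
  have add: "blk q k l F + blk q k l G = blk q k l (\<lambda>i j. F i j + G i j)" for k l F G
    by (rule finmat_eqI) (auto simp: blk.rep_eq)
  show ?thesis
  proof
    assume L: ?L
    define D where "D = y - K * K' * y"
    have yq: "supp (Suc m * q) q y" unfolding y_def blkcol_def using supp_blk[of "Suc m" q 1] by simp
    have Kq: "supp (Suc m * q) (Suc m * q) K" unfolding K_def hankel_def by (rule supp_blk)
    have KXy: "supp (Suc m * q) q (K * (X * y))" for X
    proof -
      obtain N where "supp N N X" using ex_supp by blast
      then show ?thesis using supp_mult[OF Kq supp_mult[OF _ yq]] by blast
    qed
    \<comment> \<open>The columns of \<open>y\<close> lie in the range of \<open>K\<close>.\<close>
    have "supp (Suc m * q) q D"
      unfolding D_def mult.assoc using yq KXy by simp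
    then obtain Y where Y: "D = blkcol q (Suc m) Y" "\<And>b. supp q q (Y b)"
      using blk_column_surj[OF q] unfolding blkcol_def by metis
    have "K * D = K * y - K * K * K' * y" by (simp add: D_def right_diff_distrib mult.assoc)
    also have "K * K * K' = K" using comm K'K by (metis mult.assoc)
    finally have KD: "K * D = 0" by simp
    define Y' where "Y' b = (if b \<le> m then Y b else 0)" for b
    have Y'sum: "(\<Sum>b\<le>Suc m. v (a + b) * Y' b) = (\<Sum>b\<le>m. v (a + b) * Y b)" for a
      by (simp add: Y'_def)
    have 0: "(\<Sum>b\<le>m. v (a + b) * Y b) = 0" if "a \<le> m" for a
    proof -
      have "supp q q (\<Sum>b\<le>m. v (a + b) * Y b)" if "a \<le> m" for a
        using that v Y by (intro supp_sum supp_mult[of q q _ q q]) auto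
      then show ?thesis
        using KD that unfolding Y(1) Kcol by (subst (asm) blkcol_eq_0_iff) auto
    qed
    have "(\<Sum>b\<le>Suc m. v (Suc m + b) * Y' b) = 0"
    proof (rule hankel_kernel[OF q v psd])
      show "(\<Sum>a\<le>Suc m. star (Y' a) * (\<Sum>b\<le>Suc m. v (a + b) * Y' b)) = 0"
        unfolding Y'sum using 0 by (simp add: Y'_def)
    qed (use Y in \<open>auto simp: Y'_def\<close>)
    then have yD: "star y * D = 0" unfolding Y'sum Y(1) ycol by (simp add: blk_0)
    have "star D * D = star y * D - star y * (star (K * K') * D)"
      by (simp add: D_def left_diff_distrib star_mult mult.assoc)
    also have "star (K * K') * D = K' * (K * D)" using K'K comm by (metis mult.assoc)
    finally have "star D * D = 0" by (simp add: yD KD)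
    then have y: "K * (K' * y) = y"
      using star_mult_self_eq_0[of D] by (simp add: D_def mult.assoc)
    have "K' = K * (K' * K')" using comm K'K by (metis mult.assoc)
    then have "supp (Suc m * q) q (- (K' * y))" using KXy[of "K' * K'"] by (metis mult.assoc supp_simps(3))
    then obtain Z where Z: "- (K' * y) = blkcol q (Suc m) Z" "\<And>b. supp q q (Z b)"
      using blk_column_surj[OF q] unfolding blkcol_def by metis
    define Z' where "Z' = Z(Suc m := eye q)"
    have Z'sum: "(\<Sum>b\<le>Suc m. v (a + b) * Z' b) = (\<Sum>b\<le>m. v (a + b) * Z b) + v (a + Suc m)" if "a \<le> Suc m" for a
      using that v[of "a + Suc m"] by (simp add: Z'_def mult_eye)
    have suppZ: "supp q q ((\<Sum>b\<le>m. v (a + b) * Z b) + v (a + Suc m))" if "a \<le> Suc m" for a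
      using that v Z by (intro supp_simps(2) supp_sum supp_mult[of q q _ q q]) auto
    have "(\<Sum>b\<le>Suc m. v (a + b) * Z' b) = 0" if a: "a \<le> Suc m" for a
    proof (cases "a = Suc m")
      case True
      have "blk q 1 1 (\<lambda>_ _. (\<Sum>b\<le>m. v (Suc m + b) * Z b) + v (2 * Suc m)) = star y * - (K' * y) + blk q 1 1 (\<lambda>_ _. v (2 * Suc m))"
        unfolding Z ycol by (simp add: add)
      also have "\<dots> = 0" using L by (simp add: mult.assoc)
      finally have "(\<Sum>b\<le>m. v (Suc m + b) * Z b) + v (2 * Suc m) = 0"
        using suppZ[of "Suc m"] by (subst (asm) blk_eq_0_iff) (auto simp: mult_2)
      then show ?thesis unfolding Z'sum[OF a] using True by (simp add: mult_2)
    next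
      case False
      have "blkcol q (Suc m) (\<lambda>a. (\<Sum>b\<le>m. v (a + b) * Z b) + v (a + Suc m))
        = blkcol q (Suc m) (\<lambda>a. \<Sum>b\<le>m. v (a + b) * Z b) + y"
        unfolding y_def blkcol_def add by (simp add: add.commute)
      also have "\<dots> = K * - (K' * y) + y" unfolding Z Kcol ..
      also have "\<dots> = 0" using y by simp
      finally have "\<forall>b<Suc m. (\<Sum>c\<le>m. v (b + c) * Z c) + v (b + Suc m) = 0"
        by (subst (asm) blkcol_eq_0_iff) (use suppZ in simp_all)
      then show ?thesis unfolding Z'sum[OF a] using False a by simp
    qed
    moreover have "supp q q (Z' b)" "Z' (Suc m) = eye q" for b using Z by (auto simp: Z'_def)
    ultimately show ?R by blast
  next
    assume ?R
    then obtain Y where Y: "\<And>b. supp q q (Y b)" "Y (Suc m) = eye q"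
      "\<And>a. a \<le> Suc m \<Longrightarrow> (\<Sum>b\<le>Suc m. v (a + b) * Y b) = 0" by blast
    define Z where "Z = blkcol q (Suc m) Y"
    define B where "B = blk q 1 1 (\<lambda>_ _. v (2 * Suc m))"
    have Y3: "(\<Sum>b\<le>m. v (a + b) * Y b) + v (a + Suc m) = 0" if "a \<le> Suc m" for a
      using Y(3)[OF that] v[of "a + Suc m"] Y(2) that by (simp add: mult_eye)
    have "K * Z + y = blkcol q (Suc m) (\<lambda>a. (\<Sum>b\<le>m. v (a + b) * Y b) + v (Suc m + a))"
      unfolding Z_def Kcol y_def by (simp add: blkcol_def add)
    also have "\<dots> = blkcol q (Suc m) (\<lambda>_. 0)"
      unfolding blkcol_def using Y3 by (intro blk_cong) (auto simp: add.commute)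
    finally have y: "y = - (K * Z)" by (simp add: blkcol_def blk_0 add_eq_0_iff)
    have "star y * Z + B = blk q 1 1 (\<lambda>_ _. (\<Sum>b\<le>m. v (Suc m + b) * Y b) + v (Suc m + Suc m))"
      unfolding Z_def ycol B_def by (simp add: add mult_2)
    also have "\<dots> = 0" using Y3[of "Suc m"] by (simp add: blk_0)
    finally have yZ: "star y * Z = - B" by (simp add: add_eq_0_iff2)
    have "star y * K' * y = star Z * (K * K' * K * Z)"
      by (simp add: y star_mult sK mult.assoc)
    also have "\<dots> = star Z * (K * Z)" using K'K by simp
    also have "\<dots> = - star (star y * Z)" using y by (simp add: star_mult)
    also have "\<dots> = B" unfolding yZ B_def using sv[of "2 * Suc m"] by (simp add: star_blk)
    finally show ?L by (simp add: B_def)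
  qed
qed

text \<open>The case \<open>n = 0\<close>, in which \<open>L_mat\<close> is defined separately, fits the same description.\<close>

lemma emb_L_mat:
  assumes q: "q > 0" and s: "\<And>j. j \<le> 2 * n \<Longrightarrow> s j \<in> carrier_mat q q"
    and psd: "psd (hankel q (\<lambda>j. emb (s j)) n)"
  shows "L_mat q s n = 0\<^sub>m q q \<longleftrightarrow>
    (\<exists>Y. (\<forall>b. supp q q (Y b)) \<and> Y n = eye q \<and> (\<forall>a\<le>n. (\<Sum>b\<le>n. emb (s (a + b)) * Y b) = 0))"
proof (cases n)
  case 0
  have s0: "s 0 \<in> carrier_mat q q" using s by simp
  have "L_mat q s n = 0\<^sub>m q q \<longleftrightarrow> emb (s 0) = 0"
    using 0 emb_eq_iff[OF s0 zero_carrier_mat] by (simp add: L_mat_def)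
  also have "\<dots> \<longleftrightarrow> emb (s 0) * eye q = 0" by (simp add: mult_eye[OF supp_emb[OF s0]])
  also have "\<dots> \<longleftrightarrow> (\<exists>Y. (\<forall>b. supp q q (Y b)) \<and> Y n = eye q \<and> (\<forall>a\<le>n. (\<Sum>b\<le>n. emb (s (a + b)) * Y b) = 0))"
    using 0 by (auto intro: exI[of _ "\<lambda>_. eye q"])
  finally show ?thesis .
next
  case (Suc m)
  define v where "v = (\<lambda>j. emb (s j))"
  have v: "supp q q (v j)" if "j \<le> 2 * Suc m" for j using that s Suc by (simp add: v_def)
  have psd': "psd (hankel q v (Suc m))" using psd Suc by (simp add: v_def)
  have sv: "star (v j) = v j" if "j \<le> 2 * Suc m" for j
    using hankel_hermitian_iff[of "Suc m" q v] v psd' that by (auto simp: psd_def)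
  have sK: "star (hankel q v m) = hankel q v m"
    using hankel_hermitian_iff[of m q v] v sv by auto
  define K where "K = block_hankel q s m"
  have K: "K \<in> carrier_mat (Suc m * q) (Suc m * q)" unfolding K_def by (rule block_hankel_carrier)
  have embK: "emb K = hankel q v m" unfolding K_def v_def using s Suc by (intro emb_block_hankel[OF q]) auto
  note mp = moore_penrose_hermitian[OF K, unfolded embK, OF sK]
  define y where "y = blkcol q (Suc m) (\<lambda>j. v (Suc m + j))"
  have dims: "block_row q s n (2 * n - 1) \<in> carrier_mat q (Suc m * q)" "block_col q s n (2 * n - 1) \<in> carrier_mat (Suc m * q) q"
    using Suc by (auto simp: block_row_def block_col_def)
  have sd: "dim_row (s (Suc (m + l))) = q \<and> dim_col (s (Suc (m + l))) = q" if "l < Suc m" for l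
    using that s[of "Suc (m + l)"] Suc by auto
  have row: "emb (block_row q s n (2 * n - 1)) = star y"
  proof (rule finmat_eqI)
    fix i k
    have k: "k div q < Suc m" if "k < Suc m * q" using that less_mult_imp_div_less by blast
    have "star y = blk q 1 (Suc m) (\<lambda>_ j. v (Suc m + j))"
      unfolding y_def blkcol_def star_blk using sv by (intro blk_cong) auto
    then show "entry (emb (block_row q s n (2 * n - 1))) i k = entry (star y) i k"
      using k sd Suc q by (auto simp: blk.rep_eq entry_emb[OF dims(1)] v_def emb.rep_eq) (auto simp: block_row_def)
  qed
  have col: "emb (block_col q s n (2 * n - 1)) = y"
  proof (rule finmat_eqI)
    fix i k
    have i: "i div q < Suc m" if "i < Suc m * q" using that less_mult_imp_div_less by blast
    show "entry (emb (block_col q s n (2 * n - 1))) i k = entry y i k"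
      using i sd Suc q by (auto simp: y_def blkcol_def blk.rep_eq entry_emb[OF dims(2)] v_def emb.rep_eq) (auto simp: block_col_def)
  qed
  have B: "blk q 1 1 (\<lambda>_ _. v (2 * Suc m)) = v (2 * Suc m)"
    using v[of "2 * Suc m"] by (intro finmat_eqI) (auto simp: blk.rep_eq suppD)
  have Lc: "L_mat q s n \<in> carrier_mat q q"
    using dims mp s[of "2 * n"] Suc by (auto simp: L_mat_def K_def[symmetric])
  have "emb (L_mat q s n) = v (2 * Suc m) - star y * emb (moore_penrose K) * y"
  proof -
    have c1: "block_row q s n (2 * n - 1) * moore_penrose K \<in> carrier_mat q (Suc m * q)"
      using dims mp by auto
    have "emb (L_mat q s n) = emb (s (2 * n)) - emb (block_row q s n (2 * n - 1) * moore_penrose K * block_col q s n (2 * n - 1))"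
      using dims s[of "2 * n"] Suc c1 by (simp add: L_mat_def K_def[symmetric] emb_minus[of _ q q])
    also have "emb (block_row q s n (2 * n - 1) * moore_penrose K * block_col q s n (2 * n - 1)) = star y * emb (moore_penrose K) * y"
      using emb_mult[OF c1 dims(2)] emb_mult[OF dims(1)] mp row col by metis
    finally show ?thesis using Suc by (simp add: v_def)
  qed
  then have "L_mat q s n = 0\<^sub>m q q \<longleftrightarrow> v (2 * Suc m) - star y * emb (moore_penrose K) * y = 0"
    using emb_eq_iff[OF Lc zero_carrier_mat] by simp
  also have "\<dots> \<longleftrightarrow> (\<exists>Y. (\<forall>b. supp q q (Y b)) \<and> Y (Suc m) = eye q \<and> (\<forall>a\<le>Suc m. (\<Sum>b\<le>Suc m. v (a + b) * Y b) = 0))"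
    using schur_complement_eq_0_iff[OF q v psd' conjunct2[OF mp]] by (simp only: y_def B)
  finally show ?thesis by (simp add: v_def Suc)
qed

lemma sum_lessThan_add:
  fixes f :: "nat \<Rightarrow> 'a::comm_monoid_add"
  shows "(\<Sum>i<m + n. f i) = (\<Sum>i<m. f i) + (\<Sum>i<n. f (m + i))"
  by (induction n) (simp_all add: add.assoc)

lemma fps_mult_nth_rev:
  "fps_nth (Abs_fps f * Abs_fps g) n = (\<Sum>i\<le>n. f (n - i) * g i)"
proof -
  have "fps_nth (Abs_fps f * Abs_fps g) n = (\<Sum>i=0..n. f i * g (n - i))" by (simp add: fps_mult_nth)
  also have "\<dots> = (\<Sum>i=0..n. f (n - i) * g i)"
    by (subst sum.atLeastAtMost_rev) (auto intro!: sum.cong)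
  finally show ?thesis by (simp add: atMost_atLeast0)
qed

section \<open>Reciprocal sequences and Toeplitz transforms of Hankel matrices\<close>

text \<open>Two sequences that are convolution inverses of each other up to the element \<open>P\<close>, which acts as a right
unit on both. Sequences are read as coefficients of formal power series over a ring that need not be
commutative or unital.\<close>

locale inverse_pair =
  fixes r v :: "nat \<Rightarrow> 'a::ring" and P :: 'a
  assumes left: "Abs_fps r * Abs_fps v = fps_const P"
    and right: "Abs_fps v * Abs_fps r = fps_const P"
    and r_P: "r j * P = r j" and v_P: "v j * P = v j"
begin

lemma left_sum: "(\<Sum>i\<le>n. r (n - i) * v i) = (if n = 0 then P else 0)"
  unfolding fps_mult_nth_rev[symmetric] left by simp

text \<open>Convolution on the right by \<open>r\<close> undoes convolution by \<open>v\<close>, by associativity of power series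
multiplication. The two identities below follow at once.\<close>

lemma convolve_right:
  assumes "\<And>b. N b = - fps_nth (B * Abs_fps v) b" and "fps_nth B k * P = fps_nth B k"
  shows "(\<Sum>b\<le>k. N b * r (k - b)) = - fps_nth B k"
proof -
  have "(\<Sum>b\<le>k. N b * r (k - b)) = - fps_nth (B * Abs_fps v * Abs_fps r) k"
    by (simp add: assms fps_mult_nth[of _ "Abs_fps r"] sum_negf atMost_atLeast0)
  also have "\<dots> = - fps_nth B k"
    by (simp add: mult.assoc right assms)
  finally show ?thesis .
qed

text \<open>In generating functions, \<open>V(x) - V(y)\<close> divided by \<open>x - y\<close> becomes, after multiplication by \<open>R(x)\<close> on the left
and \<open>R(y)\<close> on the right, the negative of the same quotient for \<open>R\<close>. For a fixed row, the vanishing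
convolution of \<open>r\<close> and \<open>v\<close> at index \<open>j + b + 1\<close> splits into the terms with \<open>i \<le> b\<close> and those of the sum over
\<open>a\<close>, which gives the hypothesis of \<open>convolve_right\<close>.\<close>

lemma toeplitz_hankel_shift:
  "(\<Sum>a\<le>j. \<Sum>b\<le>k. r (j - a) * v (Suc (a + b)) * r (k - b)) = - r (Suc (j + k))"
proof -
  define N where "N b = (\<Sum>a\<le>j. r (j - a) * v (Suc (a + b)))" for b
  have "(\<Sum>a\<le>j. \<Sum>b\<le>k. r (j - a) * v (Suc (a + b)) * r (k - b)) = (\<Sum>b\<le>k. N b * r (k - b))"
    unfolding N_def sum_distrib_right by (rule sum.swap)
  also have "\<dots> = - fps_nth (Abs_fps (\<lambda>c. r (Suc (j + c)))) k"
  proof (rule convolve_right)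
    fix b
    have "(\<Sum>i<Suc b + Suc j. r (Suc (j + b) - i) * v i) = 0"
      using left_sum[of "Suc (j + b)"] by (simp add: lessThan_Suc_atMost add.commute)
    then have "(\<Sum>i<Suc b. r (Suc (j + b) - i) * v i) + N b = 0"
      unfolding sum_lessThan_add N_def by (simp add: lessThan_Suc_atMost add.commute)
    then have "N b = - (\<Sum>i\<le>b. r (Suc (j + b) - i) * v i)"
      by (simp add: lessThan_Suc_atMost add_eq_0_iff)
    then show "N b = - fps_nth (Abs_fps (\<lambda>c. r (Suc (j + c))) * Abs_fps v) b"
      unfolding fps_mult_nth_rev by (auto simp: Suc_diff_le intro!: sum.cong)
  qed (simp add: r_P)
  finally show ?thesis by simp
qed

text \<open>The analogue for the unshifted Hankel matrix, below its first block row: the Toeplitz transform splits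
off the first block row and column, and what remains is again Hankel. It is a block version of the
Schur complement of the first entry.\<close>

lemma toeplitz_hankel:
  "(\<Sum>a\<le>Suc j. \<Sum>b\<le>k. r (Suc j - a) * v (a + b) * r (k - b)) = (if k = 0 then 0 else - r (Suc (j + k)))"
proof -
  define N where "N b = (\<Sum>a\<le>Suc j. r (Suc j - a) * v (a + b))" for b
  have "(\<Sum>a\<le>Suc j. \<Sum>b\<le>k. r (Suc j - a) * v (a + b) * r (k - b)) = (\<Sum>b\<le>k. N b * r (k - b))"
    unfolding N_def sum_distrib_right by (rule sum.swap)
  also have "\<dots> = - fps_nth (Abs_fps (\<lambda>c. if c = 0 then 0 else r (Suc (j + c)))) k"
  proof (rule convolve_right)
    fix b
    have "(\<Sum>i<b + Suc (Suc j). r (Suc (j + b) - i) * v i) = 0"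
      using left_sum[of "Suc (j + b)"] by (simp add: lessThan_Suc_atMost add.commute)
    then have "(\<Sum>i<b. r (Suc (j + b) - i) * v i) + N b = 0"
      unfolding sum_lessThan_add N_def by (simp add: lessThan_Suc_atMost add.commute)
    then have "N b = - (\<Sum>i<b. r (Suc (j + b) - i) * v i)"
      by (simp add: add_eq_0_iff)
    also have "(\<Sum>i<b. r (Suc (j + b) - i) * v i) = (\<Sum>i\<le>b. (if b - i = 0 then 0 else r (Suc (j + (b - i)))) * v i)"
      by (intro sum.mono_neutral_cong_left) (auto simp: Suc_diff_le)
    finally show "N b = - fps_nth (Abs_fps (\<lambda>c. if c = 0 then 0 else r (Suc (j + c))) * Abs_fps v) b"
      unfolding fps_mult_nth_rev .
  qed (simp add: r_P)
  finally show ?thesis by simp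
qed

lemma toeplitz_inverse:
  assumes "k \<le> n" "j \<le> n"
  shows "(\<Sum>b\<le>n. (if k \<le> b then v (b - k) else 0) * (if b \<le> j then r (j - b) else 0)) = (if k = j then P else 0)"
proof (cases "k \<le> j")
  case True
  have "(\<Sum>b\<le>n. (if k \<le> b then v (b - k) else 0) * (if b \<le> j then r (j - b) else 0)) = (\<Sum>b=k..j. v (b - k) * r (j - b))"
    using assms by (intro sum.mono_neutral_cong_right) auto
  also have "\<dots> = (\<Sum>b=0..j-k. v b * r (j - k - b))"
    using True by (intro sum.reindex_bij_witness[of _ "\<lambda>b. b + k" "\<lambda>b. b - k"]) auto
  also have "\<dots> = fps_nth (Abs_fps v * Abs_fps r) (j - k)" by (simp add: fps_mult_nth)
  finally show ?thesis using True by (simp add: right)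
next
  case False
  then show ?thesis by (auto intro!: sum.neutral)
qed

text \<open>Since the Toeplitz matrices of \<open>r\<close> and \<open>v\<close> are mutually inverse up to \<open>P\<close>, applying the Toeplitz matrix of
\<open>v\<close> to a kernel column of a matrix \<open>g\<close> yields a kernel column of its Toeplitz transform.\<close>

lemma kernel_transport:
  assumes Y: "\<And>a. a \<le> n \<Longrightarrow> (\<Sum>b\<le>n. g a b * Y b) = 0"
    and gP: "\<And>a b. g a b * P = g a b" and j: "j \<le> n"
  defines "Z \<equiv> \<lambda>k. \<Sum>c\<le>n. (if k \<le> c then v (c - k) else 0) * Y c"
  shows "(\<Sum>k\<le>n. (\<Sum>a\<le>j. \<Sum>b\<le>k. r (j - a) * g a b * r (k - b)) * Z k) = 0"
proof -
  have *: "(\<Sum>k\<le>n. (if b \<le> k then r (k - b) else 0) * Z k) = P * Y b" if "b \<le> n" for b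
  proof -
    interpret sym: inverse_pair v r P by unfold_locales (auto simp: left right r_P v_P)
    have "(\<Sum>k\<le>n. (if b \<le> k then r (k - b) else 0) * Z k) =
      (\<Sum>k\<le>n. \<Sum>c\<le>n. (if b \<le> k then r (k - b) else 0) * (if k \<le> c then v (c - k) else 0) * Y c)"
      by (simp only: Z_def sum_distrib_left mult.assoc)
    also have "\<dots> = (\<Sum>c\<le>n. (\<Sum>k\<le>n. (if b \<le> k then r (k - b) else 0) * (if k \<le> c then v (c - k) else 0)) * Y c)"
      by (subst sum.swap) (simp only: sum_distrib_right)
    also have "\<dots> = (\<Sum>c\<le>n. if b = c then P * Y b else 0)"
      using that by (intro sum.cong) (auto simp: sym.toeplitz_inverse)
    finally show ?thesis using that by simp
  qed
  have eq: "(\<Sum>b\<le>k. r (j - a) * g a b * r (k - b)) = (\<Sum>b\<le>n. r (j - a) * g a b * (if b \<le> k then r (k - b) else 0))"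
    if "k \<le> n" for k a
    using that by (intro sum.mono_neutral_cong_left) auto
  have "(\<Sum>k\<le>n. (\<Sum>a\<le>j. \<Sum>b\<le>k. r (j - a) * g a b * r (k - b)) * Z k)
    = (\<Sum>k\<le>n. (\<Sum>a\<le>j. \<Sum>b\<le>n. r (j - a) * g a b * (if b \<le> k then r (k - b) else 0)) * Z k)"
    by (intro sum.cong refl) (simp only: eq atMost_iff)
  also have "\<dots> = (\<Sum>k\<le>n. \<Sum>a\<le>j. \<Sum>b\<le>n. r (j - a) * (g a b * ((if b \<le> k then r (k - b) else 0) * Z k)))"
    by (simp only: sum_distrib_right mult.assoc)
  also have "\<dots> = (\<Sum>a\<le>j. \<Sum>b\<le>n. \<Sum>k\<le>n. r (j - a) * (g a b * ((if b \<le> k then r (k - b) else 0) * Z k)))"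
    by (subst sum.swap) (intro sum.cong refl sum.swap)
  also have "\<dots> = (\<Sum>a\<le>j. r (j - a) * (\<Sum>b\<le>n. g a b * (\<Sum>k\<le>n. (if b \<le> k then r (k - b) else 0) * Z k)))"
    by (simp only: sum_distrib_left)
  also have "\<dots> = (\<Sum>a\<le>j. r (j - a) * (\<Sum>b\<le>n. g a b * Y b))"
  proof -
    have "g a b * (P * Y b) = g a b * Y b" for a b by (metis gP mult.assoc)
    then show ?thesis by (simp add: *)
  qed
  also have "\<dots> = 0" using Y j by (intro sum.neutral) auto
  finally show ?thesis .
qed

end

fun reciprocal :: "'a::ring \<Rightarrow> (nat \<Rightarrow> 'a) \<Rightarrow> nat \<Rightarrow> 'a" where
  "reciprocal d u 0 = d"
| "reciprocal d u (Suc j) = - (d * (\<Sum>l\<le>j. u (Suc j - l) * reciprocal d u l))"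

lemma reciprocal_right:
  assumes "u 0 * d = P" "\<And>j. P * u j = u j"
  shows "Abs_fps u * Abs_fps (reciprocal d u) = fps_const P"
proof (rule fps_ext)
  fix n
  show "fps_nth (Abs_fps u * Abs_fps (reciprocal d u)) n = fps_nth (fps_const P) n"
  proof (cases n)
    case 0
    then show ?thesis unfolding fps_mult_nth_rev using assms by simp
  next
    case (Suc j)
    have "(\<Sum>i\<le>Suc j. u (Suc j - i) * reciprocal d u i) = (\<Sum>i\<le>j. u (Suc j - i) * reciprocal d u i) - P * (\<Sum>l\<le>j. u (Suc j - l) * reciprocal d u l)"
      by (simp add: assms(1)[symmetric] mult.assoc)
    also have "\<dots> = 0" by (simp add: sum_distrib_left mult.assoc[symmetric] assms(2))
    finally show ?thesis unfolding fps_mult_nth_rev Suc by simp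
  qed
qed

definition fps_star :: "finmat fps \<Rightarrow> finmat fps" where "fps_star f = Abs_fps (\<lambda>n. star (fps_nth f n))"

lemma fps_star_mult: "fps_star (f * g) = fps_star g * fps_star f"
proof (rule fps_ext)
  fix n
  have "fps_nth (fps_star (f * g)) n = (\<Sum>i=0..n. star (fps_nth g (n - i)) * star (fps_nth f i))"
    by (simp add: fps_star_def fps_mult_nth star_sum star_mult)
  also have "\<dots> = fps_nth (fps_star g * fps_star f) n"
    unfolding fps_star_def fps_mult_nth_rev by (simp add: atMost_atLeast0)
  finally show "fps_nth (fps_star (f * g)) n = fps_nth (fps_star g * fps_star f) n" .
qed

text \<open>The recursion produces a right inverse \<open>W\<close> of \<open>U\<close> up to \<open>P\<close>. Its adjoint is a left inverse because \<open>U\<close> is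
Hermitian, and a left inverse equals a right inverse. So \<open>W\<close> is two-sided and Hermitian.\<close>

lemma reciprocal_hermitian_inverse_pair:
  fixes u :: "nat \<Rightarrow> finmat"
  assumes u: "\<And>j. star (u j) = u j" "\<And>j. P * u j = u j"
    and d: "star d = d" "u 0 * d = P" "P * d = d" and P: "star P = P"
  shows "inverse_pair (reciprocal d u) u P" "star (reciprocal d u j) = reciprocal d u j"
proof -
  define U W V where "U = Abs_fps u" "W = Abs_fps (reciprocal d u)" "V = fps_star W"
  have UW: "U * W = fps_const P" unfolding U_W_V_def using d u by (intro reciprocal_right)
  have "fps_star U = U" "fps_star (fps_const P) = fps_const P"
    by (rule fps_ext; simp add: U_W_V_def(1) fps_star_def u P)+
  then have VU: "V * U = fps_const P" using UW fps_star_mult[of U W] by (simp add: U_W_V_def(3))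
  have Pw: "P * reciprocal d u n = reciprocal d u n" for n
    by (cases n) (simp_all add: d(3) mult.assoc[symmetric])
  then have PW: "fps_const P * W = W" by (intro fps_ext) (simp add: U_W_V_def(2))
  have wP: "star (reciprocal d u n) * P = star (reciprocal d u n)" for n by (metis P Pw star_mult)
  then have VP: "V * fps_const P = V" by (intro fps_ext) (simp add: U_W_V_def fps_star_def)
  have "V = V * (U * W)" by (simp add: UW VP)
  also have "\<dots> = W" by (simp add: mult.assoc[symmetric] VU PW)
  finally have VW: "V = W" .
  then have "Abs_fps (\<lambda>n. star (reciprocal d u n)) = Abs_fps (reciprocal d u)" by (simp add: U_W_V_def fps_star_def)
  then have sw: "star (reciprocal d u n) = reciprocal d u n" for n by (metis fps_nth_Abs_fps)
  then show "star (reciprocal d u j) = reciprocal d u j" .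
  have "u j * P = u j" for j by (metis P u star_mult)
  then show "inverse_pair (reciprocal d u) u P"
    using UW VU VW wP sw by unfold_locales (auto simp: U_W_V_def(1,2))
qed

text \<open>Multiplication by the indeterminate, which is not itself a power series over a ring without unit.\<close>

definition shift_fps :: "'a::zero fps \<Rightarrow> 'a fps" where
  "shift_fps f = Abs_fps (\<lambda>n. case n of 0 \<Rightarrow> 0 | Suc i \<Rightarrow> fps_nth f i)"

lemma shift_fps_mult:
  fixes f g :: "'a::ring fps"
  shows "shift_fps f * g = shift_fps (f * g)" "f * shift_fps g = shift_fps (f * g)"
proof -
  show "shift_fps f * g = shift_fps (f * g)"
  proof (rule fps_ext)
    fix n show "fps_nth (shift_fps f * g) n = fps_nth (shift_fps (f * g)) n"
    proof (cases n)
      case (Suc m)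
      then show ?thesis
        unfolding fps_mult_nth Suc shift_fps_def by (subst sum.atLeast0_atMost_Suc_shift) (simp add: fps_mult_nth)
    qed (simp add: shift_fps_def fps_mult_nth)
  qed
  show "f * shift_fps g = shift_fps (f * g)"
  proof (rule fps_ext)
    fix n show "fps_nth (f * shift_fps g) n = fps_nth (shift_fps (f * g)) n"
      by (cases n) (auto simp: shift_fps_def fps_mult_nth Suc_diff_le intro!: sum.cong)
  qed
qed


section \<open>The Schur step on compressed sequences\<close>

text \<open>A Hermitian sequence \<open>\<sigma>\<close> whose entries all act within the range of \<open>\<sigma> 0\<close>: here \<open>d\<close> is the Moore-Penrose
inverse of \<open>\<sigma> 0\<close> and \<open>P\<close> the orthogonal projection onto its range. Below, \<open>u\<close> is the \<open>[+,\<alpha>]\<close>-transform of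
\<open>\<sigma>\<close>, \<open>w\<close> its reciprocal, \<open>x\<close> the reciprocal of \<open>\<sigma>\<close> itself, and \<open>t\<close> the first Schur transform.\<close>

locale schur_step =
  fixes q :: nat and \<alpha> :: real and \<sigma> :: "nat \<Rightarrow> finmat" and d P :: finmat
  assumes herm: "star (\<sigma> j) = \<sigma> j" and d_herm: "star d = d" and P_herm: "star P = P"
    and \<sigma>0_d: "\<sigma> 0 * d = P" and d_\<sigma>0: "d * \<sigma> 0 = P" and P_\<sigma>: "P * \<sigma> j = \<sigma> j" and P_d: "P * d = d"
    and supp_\<sigma>: "supp q q (\<sigma> j)" and supp_d: "supp q q d"
begin

definition u :: "nat \<Rightarrow> finmat" where
  "u j = (case j of 0 \<Rightarrow> \<sigma> 0 | Suc i \<Rightarrow> \<sigma> (Suc i) - \<alpha> *\<^sub>R \<sigma> i)"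

definition w :: "nat \<Rightarrow> finmat" where "w = reciprocal d u"

definition x :: "nat \<Rightarrow> finmat" where
  "x j = (case j of 0 \<Rightarrow> w 0 | Suc i \<Rightarrow> w (Suc i) - \<alpha> *\<^sub>R w i)"

definition t :: "nat \<Rightarrow> finmat" where "t j = - (\<sigma> 0 * w (Suc j) * \<sigma> 0)"

lemma \<sigma>_P: "\<sigma> j * P = \<sigma> j"
  by (metis P_\<sigma> P_herm herm star_mult)

lemma d_P: "d * P = d"
  by (metis P_d P_herm d_herm star_mult)

lemma supp_P: "supp q q P"
  using supp_mult[OF supp_\<sigma>[of 0] supp_d] \<sigma>0_d by simp

lemma u_0: "u 0 = \<sigma> 0" and u_Suc: "u (Suc i) = \<sigma> (Suc i) - \<alpha> *\<^sub>R \<sigma> i"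
  by (simp_all add: u_def)

lemma star_u: "star (u j) = u j" and P_u: "P * u j = u j"
  by (cases j; simp add: u_0 u_Suc herm P_\<sigma> right_diff_distrib)+

lemma supp_u: "supp q q (u j)"
  by (cases j) (simp_all add: u_0 u_Suc supp_\<sigma>)

lemma w_u: "inverse_pair w u P" and star_w: "star (w j) = w j"
  unfolding w_def using reciprocal_hermitian_inverse_pair[of u P d] star_u P_u d_herm P_herm \<sigma>0_d P_d
  by (auto simp: u_0)

sublocale wu: inverse_pair w u P by (rule w_u)

lemma P_w: "P * w j = w j"
  by (metis P_herm star_mult star_w wu.r_P)

lemma supp_w: "supp q q (w j)"
proof -
  obtain N where N: "supp N N (w j)" using ex_supp by blast
  have "supp q N (P * w j)" by (rule supp_mult[OF supp_P N])
  then have "supp q q (w j * P)" unfolding P_w by (rule supp_mult[OF _ supp_P])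
  then show ?thesis by (simp add: wu.r_P)
qed

lemma x_0: "x 0 = w 0" and x_Suc: "x (Suc i) = w (Suc i) - \<alpha> *\<^sub>R w i"
  by (simp_all add: x_def)

lemma star_x: "star (x j) = x j" and x_P: "x j * P = x j" and supp_x: "supp q q (x j)"
  by (cases j; simp add: x_0 x_Suc star_w wu.r_P left_diff_distrib supp_w)+

text \<open>Formally \<open>U(z) = (1 - \<alpha> z) S(z)\<close> and \<open>X(z) = (1 - \<alpha> z) W(z)\<close>, so \<open>X S = W U\<close> and \<open>S X = U W\<close>.\<close>

lemma x_\<sigma>: "inverse_pair x \<sigma> P"
proof
  define S W where "S = Abs_fps \<sigma>" "W = Abs_fps w"
  have U: "Abs_fps u = S - shift_fps (Abs_fps (\<lambda>n. \<alpha> *\<^sub>R \<sigma> n))"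
    by (rule fps_ext) (simp add: u_def S_W_def shift_fps_def split: nat.split)
  have X: "Abs_fps x = W - shift_fps (Abs_fps (\<lambda>n. \<alpha> *\<^sub>R w n))"
    by (rule fps_ext) (simp add: x_def S_W_def shift_fps_def split: nat.split)
  have "Abs_fps (\<lambda>n. \<alpha> *\<^sub>R w n) * S = W * Abs_fps (\<lambda>n. \<alpha> *\<^sub>R \<sigma> n)"
    "S * Abs_fps (\<lambda>n. \<alpha> *\<^sub>R w n) = Abs_fps (\<lambda>n. \<alpha> *\<^sub>R \<sigma> n) * W"
    by (rule fps_ext; simp add: S_W_def fps_mult_nth)+
  then have "Abs_fps x * S = W * Abs_fps u" "S * Abs_fps x = Abs_fps u * W"
    unfolding U X left_diff_distrib right_diff_distrib shift_fps_mult by simp_all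
  then show "Abs_fps x * Abs_fps \<sigma> = fps_const P" "Abs_fps \<sigma> * Abs_fps x = fps_const P"
    using wu.left wu.right by (simp_all add: S_W_def)
qed (rule x_P \<sigma>_P)+

sublocale x\<sigma>: inverse_pair x \<sigma> P by (rule x_\<sigma>)

text \<open>By this identity the \<open>\<alpha>\<close>-shift of the Schur transform is built from the reciprocal of \<open>\<sigma>\<close> in the same way
as \<open>t\<close> is built from the reciprocal of \<open>u\<close>, with the index raised by one.\<close>

lemma t_shifted: "t (Suc j) - \<alpha> *\<^sub>R t j = - (\<sigma> 0 * x (Suc (Suc j)) * \<sigma> 0)"
  by (simp add: t_def x_Suc right_diff_distrib left_diff_distrib)

text \<open>The block Toeplitz factors of the two congruences. \<open>A\<close> is square. \<open>B\<close> has one more block column than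
block rows: it is a square Toeplitz matrix without its first block row.\<close>

definition A :: "nat \<Rightarrow> nat \<Rightarrow> finmat" where "A j a = (if a \<le> j then \<sigma> 0 * w (j - a) else 0)"

definition B :: "nat \<Rightarrow> nat \<Rightarrow> finmat" where "B j a = (if a \<le> Suc j then \<sigma> 0 * x (Suc j - a) else 0)"

lemma supp_A: "supp q q (A j a)" and supp_B: "supp q q (B j a)"
  using supp_mult[OF supp_\<sigma> supp_w] supp_mult[OF supp_\<sigma> supp_x] by (auto simp: A_def B_def)

lemma A_P: "A j a * P = A j a" and B_P: "B j a * P = B j a"
  by (auto simp: A_def B_def mult.assoc wu.r_P x_P)

lemma star_A: "star (A j a) = (if a \<le> j then w (j - a) * \<sigma> 0 else 0)"
  and star_B: "star (B j a) = (if a \<le> Suc j then x (Suc j - a) * \<sigma> 0 else 0)"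
  by (auto simp: A_def B_def star_mult star_w star_x herm)

lemma t_congruence:
  assumes "j \<le> n" "k \<le> n"
  shows "t (j + k) = (\<Sum>a\<le>n. \<Sum>b\<le>n. A j a * u (Suc (a + b)) * star (A k b))"
proof -
  have "(\<Sum>a\<le>n. \<Sum>b\<le>n. A j a * u (Suc (a + b)) * star (A k b))
    = (\<Sum>a\<le>j. \<Sum>b\<le>k. \<sigma> 0 * (w (j - a) * u (Suc (a + b)) * w (k - b)) * \<sigma> 0)"
    using assms by (intro sum.mono_neutral_cong_right)
      (auto simp: A_def star_mult star_w herm mult.assoc intro!: sum.mono_neutral_cong_right)
  also have "\<dots> = \<sigma> 0 * (\<Sum>a\<le>j. \<Sum>b\<le>k. w (j - a) * u (Suc (a + b)) * w (k - b)) * \<sigma> 0"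
    by (simp only: sum_distrib_left sum_distrib_right)
  finally show ?thesis by (simp add: wu.toeplitz_hankel_shift t_def)
qed

lemma t_shifted_congruence:
  assumes "j \<le> n" "k \<le> n"
  shows "t (Suc (j + k)) - \<alpha> *\<^sub>R t (j + k) = (\<Sum>a\<le>Suc n. \<Sum>b\<le>Suc n. B j a * \<sigma> (a + b) * star (B k b))"
proof -
  have "(\<Sum>a\<le>Suc n. \<Sum>b\<le>Suc n. B j a * \<sigma> (a + b) * star (B k b))
    = (\<Sum>a\<le>Suc j. \<Sum>b\<le>Suc k. \<sigma> 0 * (x (Suc j - a) * \<sigma> (a + b) * x (Suc k - b)) * \<sigma> 0)"
    using assms by (intro sum.mono_neutral_cong_right)
      (auto simp: B_def star_mult star_x herm mult.assoc intro!: sum.mono_neutral_cong_right)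
  also have "\<dots> = \<sigma> 0 * (\<Sum>a\<le>Suc j. \<Sum>b\<le>Suc k. x (Suc j - a) * \<sigma> (a + b) * x (Suc k - b)) * \<sigma> 0"
    by (simp only: sum_distrib_left sum_distrib_right)
  also have "\<dots> = t (Suc (j + k)) - \<alpha> *\<^sub>R t (j + k)"
    unfolding x\<sigma>.toeplitz_hankel by (simp add: t_shifted)
  finally show ?thesis ..
qed

text \<open>Up to \<open>P\<close>, the adjoints of both factors have explicit left inverses, so the congruences preserve
definiteness when \<open>P\<close> is the identity.\<close>

lemma A_left_inverse:
  assumes "j \<le> n" "k \<le> n"
  shows "(\<Sum>b\<le>n. (d * (if k \<le> b then u (b - k) else 0)) * star (A j b)) = (if k = j then P else 0)"
proof -
  have "(\<Sum>b\<le>n. (d * (if k \<le> b then u (b - k) else 0)) * star (A j b))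
    = d * (\<Sum>b\<le>n. (if k \<le> b then u (b - k) else 0) * (if b \<le> j then w (j - b) else 0)) * \<sigma> 0"
    unfolding sum_distrib_left sum_distrib_right by (intro sum.cong) (auto simp: star_A mult.assoc)
  then show ?thesis using assms by (simp add: wu.toeplitz_inverse d_P d_\<sigma>0)
qed

lemma B_left_inverse:
  assumes "j \<le> n" "k \<le> n"
  shows "(\<Sum>b\<le>Suc n. (d * (if Suc k \<le> b then \<sigma> (b - Suc k) else 0)) * star (B j b)) = (if k = j then P else 0)"
proof -
  have "(\<Sum>b\<le>Suc n. (d * (if Suc k \<le> b then \<sigma> (b - Suc k) else 0)) * star (B j b))
    = d * (\<Sum>b\<le>Suc n. (if Suc k \<le> b then \<sigma> (b - Suc k) else 0) * (if b \<le> Suc j then x (Suc j - b) else 0)) * \<sigma> 0"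
    unfolding sum_distrib_left sum_distrib_right by (intro sum.cong) (auto simp: star_B mult.assoc)
  then show ?thesis using assms by (subst (asm) x\<sigma>.toeplitz_inverse) (auto simp: d_P d_\<sigma>0)
qed

lemma t_mult_P_complement: "t j * (eye q - P) = 0"
  by (simp add: t_def right_diff_distrib mult.assoc \<sigma>_P mult_eye[OF supp_\<sigma>])

text \<open>A transported kernel column ends in \<open>P\<close>, not in the identity. The missing projection \<open>1 - P\<close> is itself
annihilated by the matrix and can be added in the last slot.\<close>

lemma complete_column:
  fixes f :: "nat \<Rightarrow> finmat" and n :: nat
  assumes f: "\<And>a. a \<le> n \<Longrightarrow> (\<Sum>b\<le>n. f (a + b) * Z b) = 0" and Z: "Z n = P" "\<And>b. supp q q (Z b)"
    and fP: "\<And>j. f j * (eye q - P) = 0"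
  shows "\<exists>Y. (\<forall>b. supp q q (Y b)) \<and> Y n = eye q \<and> (\<forall>a\<le>n. (\<Sum>b\<le>n. f (a + b) * Y b) = 0)"
proof (intro exI conjI allI impI)
  define Y where "Y b = Z b + (if b = n then eye q - P else 0)" for b
  show "supp q q (Y b)" for b using Z supp_P by (simp add: Y_def)
  show "Y n = eye q" using Z by (simp add: Y_def)
  fix a assume "a \<le> n"
  have "f (a + b) * Y b = f (a + b) * Z b" for b
    using fP[of "a + b"] by (cases "b = n") (auto simp: Y_def distrib_left)
  then show "(\<Sum>b\<le>n. f (a + b) * Y b) = 0" using f[OF \<open>a \<le> n\<close>] by simp
qed

lemma t_degenerate:
  assumes Y: "\<And>b. supp q q (Y b)" "Y n = eye q" "\<And>a. a \<le> n \<Longrightarrow> (\<Sum>b\<le>n. u (Suc (a + b)) * Y b) = 0"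
  shows "\<exists>Y. (\<forall>b. supp q q (Y b)) \<and> Y n = eye q \<and> (\<forall>a\<le>n. (\<Sum>b\<le>n. t (a + b) * Y b) = 0)"
proof -
  define Z where "Z k = (\<Sum>c\<le>n. (if k \<le> c then u (c - k) else 0) * Y c)" for k
  show ?thesis
  proof (rule complete_column[where Z = "\<lambda>b. d * Z b"])
    have "Z n = (\<Sum>c\<le>n. if c = n then u 0 * Y n else 0)"
      unfolding Z_def by (intro sum.cong) auto
    then show "d * Z n = P" using Y by (simp add: u_0 mult_eye[OF supp_\<sigma>] d_\<sigma>0)
    have "supp q q (Z b)" for b unfolding Z_def using Y supp_u by (intro supp_sum supp_mult[of q q _ q q]) auto
    then show "supp q q (d * Z b)" for b by (rule supp_mult[OF supp_d])
    show "(\<Sum>b\<le>n. t (a + b) * (d * Z b)) = 0" if a: "a \<le> n" for a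
    proof -
      have "t (a + b) * (d * Z b) = \<sigma> 0 * ((\<Sum>i\<le>a. \<Sum>c\<le>b. w (a - i) * u (Suc (i + c)) * w (b - c)) * Z b)" for b
        by (simp add: wu.toeplitz_hankel_shift t_def mult.assoc[symmetric] \<sigma>0_d)
          (metis mult.assoc \<sigma>0_d wu.r_P)
      then have "(\<Sum>b\<le>n. t (a + b) * (d * Z b)) = \<sigma> 0 * (\<Sum>b\<le>n. (\<Sum>i\<le>a. \<Sum>c\<le>b. w (a - i) * u (Suc (i + c)) * w (b - c)) * Z b)"
        by (simp only: sum_distrib_left)
      also have "\<dots> = 0"
        unfolding Z_def using wu.kernel_transport[of n "\<lambda>a b. u (Suc (a + b))" Y a] Y(3) a by (simp add: wu.v_P)
      finally show ?thesis .
    qed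
  qed (rule t_mult_P_complement)
qed

lemma t_shifted_degenerate:
  assumes Y: "\<And>b. supp q q (Y b)" "Y (Suc n) = eye q" "\<And>a. a \<le> Suc n \<Longrightarrow> (\<Sum>b\<le>Suc n. \<sigma> (a + b) * Y b) = 0"
  defines "f \<equiv> \<lambda>j. t (Suc j) - \<alpha> *\<^sub>R t j"
  shows "\<exists>Y. (\<forall>b. supp q q (Y b)) \<and> Y n = eye q \<and> (\<forall>a\<le>n. (\<Sum>b\<le>n. f (a + b) * Y b) = 0)"
proof -
  define Z where "Z k = (\<Sum>c\<le>Suc n. (if k \<le> c then \<sigma> (c - k) else 0) * Y c)" for k
  show ?thesis
  proof (rule complete_column[where Z = "\<lambda>b. d * Z (Suc b)"])
    have "Z (Suc n) = (\<Sum>c\<le>Suc n. if c = Suc n then \<sigma> 0 * Y (Suc n) else 0)"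
      unfolding Z_def by (intro sum.cong) auto
    then show "d * Z (Suc n) = P" using Y by (simp add: mult_eye[OF supp_\<sigma>] d_\<sigma>0)
    have "supp q q (Z b)" for b unfolding Z_def using Y supp_\<sigma> by (intro supp_sum supp_mult[of q q _ q q]) auto
    then show "supp q q (d * Z (Suc b))" for b by (rule supp_mult[OF supp_d])
    show "(\<Sum>b\<le>n. f (a + b) * (d * Z (Suc b))) = 0" if a: "a \<le> n" for a
    proof -
      define M where "M k = (\<Sum>i\<le>Suc a. \<Sum>c\<le>k. x (Suc a - i) * \<sigma> (i + c) * x (k - c))" for k
      have M: "M k = (if k = 0 then 0 else - x (Suc (a + k)))" for k
        unfolding M_def by (rule x\<sigma>.toeplitz_hankel)
      have "f (a + b) * (d * Z (Suc b)) = \<sigma> 0 * (M (Suc b) * Z (Suc b))" for b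
      proof -
        have "f (a + b) * (d * Z (Suc b)) = - (\<sigma> 0 * (x (Suc (Suc (a + b))) * (\<sigma> 0 * d)) * Z (Suc b))"
          by (simp add: f_def t_shifted mult.assoc)
        then show ?thesis by (simp add: M \<sigma>0_d x_P mult.assoc)
      qed
      then have "(\<Sum>b\<le>n. f (a + b) * (d * Z (Suc b))) = \<sigma> 0 * (\<Sum>b\<le>n. M (Suc b) * Z (Suc b))"
        by (simp only: sum_distrib_left)
      also have "(\<Sum>b\<le>n. M (Suc b) * Z (Suc b)) = (\<Sum>b\<le>Suc n. M b * Z b)"
        unfolding sum.atMost_Suc_shift[of _ n] by (simp add: M)
      also have "\<dots> = 0"
        unfolding Z_def M_def using x\<sigma>.kernel_transport[of "Suc n" "\<lambda>a b. \<sigma> (a + b)" Y "Suc a"] Y(3) a by (simp add: \<sigma>_P)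
      finally show ?thesis by simp
    qed
  qed (simp add: f_def left_diff_distrib t_mult_P_complement)
qed

end

section \<open>The classes in terms of block Hankel matrices over the algebra\<close>

definition alpha_shift :: "real \<Rightarrow> (nat \<Rightarrow> finmat) \<Rightarrow> nat \<Rightarrow> finmat" where
  "alpha_shift \<alpha> v j = v (Suc j) - \<alpha> *\<^sub>R v j"

lemma hankel_cong: "(\<And>j. j \<le> 2 * n \<Longrightarrow> f j = g j) \<Longrightarrow> hankel q f n = hankel q g n"
  unfolding hankel_def by (intro blk_cong) auto

lemma hankel_0: "supp q q (v 0) \<Longrightarrow> hankel q v 0 = v 0"
  by (rule finmat_eqI) (auto simp: hankel_def blk.rep_eq suppD)

lemma shifted_seq_carrier:
  "s j \<in> carrier_mat q q \<Longrightarrow> s (Suc j) \<in> carrier_mat q q \<Longrightarrow> shifted_seq \<alpha> s j \<in> carrier_mat q q"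
  by (simp add: shifted_seq_def)

lemma emb_shifted_seq:
  "s j \<in> carrier_mat q q \<Longrightarrow> s (Suc j) \<in> carrier_mat q q \<Longrightarrow> emb (shifted_seq \<alpha> s j) = alpha_shift \<alpha> (\<lambda>j. emb (s j)) j"
  unfolding shifted_seq_def alpha_shift_def
  by (subst emb_add[of _ q q]) (auto simp: emb_smult[of "- \<alpha>", simplified])

lemma emb_block_hankel_shifted:
  assumes "q > 0" "\<And>j. j \<le> Suc (2 * n) \<Longrightarrow> s j \<in> carrier_mat q q"
  shows "emb (block_hankel q (shifted_seq \<alpha> s) n) = hankel q (alpha_shift \<alpha> (\<lambda>j. emb (s j))) n"
proof -
  have "emb (block_hankel q (shifted_seq \<alpha> s) n) = hankel q (\<lambda>j. emb (shifted_seq \<alpha> s j)) n"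
    using assms by (intro emb_block_hankel shifted_seq_carrier) auto
  also have "\<dots> = hankel q (alpha_shift \<alpha> (\<lambda>j. emb (s j))) n"
    using assms by (intro hankel_cong emb_shifted_seq[of _ _ q]) auto
  finally show ?thesis .
qed

text \<open>For both parities of \<open>m > 0\<close> the orders of the two Hankel matrices are \<open>m div 2\<close> and
\<open>(m - 1) div 2\<close>, which removes the case distinctions from the arguments below.\<close>

lemma K_nonneg_fin_iff:
  assumes q: "q > 0"
  shows "s \<in> K_nonneg_fin q \<alpha> m \<longleftrightarrow> (\<forall>j\<le>m. s j \<in> carrier_mat q q) \<and>
    psd (hankel q (\<lambda>j. emb (s j)) (m div 2)) \<and>
    (m \<noteq> 0 \<longrightarrow> psd (hankel q (alpha_shift \<alpha> (\<lambda>j. emb (s j))) ((m - 1) div 2)))"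
proof (cases "\<forall>j\<le>m. s j \<in> carrier_mat q q")
  case c: True
  have 1: "nonneg_hermitian (block_hankel q s (m div 2)) \<longleftrightarrow> psd (hankel q (\<lambda>j. emb (s j)) (m div 2))"
    using c by (subst nonneg_hermitian_emb[OF block_hankel_carrier], subst emb_block_hankel[OF q]) auto
  have 2: "nonneg_hermitian (block_hankel q (shifted_seq \<alpha> s) ((m - 1) div 2))
      \<longleftrightarrow> psd (hankel q (alpha_shift \<alpha> (\<lambda>j. emb (s j))) ((m - 1) div 2))" if "m \<noteq> 0"
  proof -
    have "Suc (2 * ((m - 1) div 2)) \<le> m" using that by presburger
    then show ?thesis
      using c by (subst nonneg_hermitian_emb[OF block_hankel_carrier], subst emb_block_hankel_shifted[OF q]) auto
  qed
  have s0: "s 0 \<in> carrier_mat q q" using c by simp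
  have 3: "nonneg_hermitian (s 0) \<longleftrightarrow> psd (hankel q (\<lambda>j. emb (s j)) 0)"
    using nonneg_hermitian_emb[OF s0] hankel_0[of q "\<lambda>j. emb (s j)"] supp_emb[OF s0] by simp
  have "m div 2 - 1 = (m - 1) div 2" if "even m" using that by presburger
  moreover have "m div 2 = (m - 1) div 2" if "odd m" using that by presburger
  ultimately show ?thesis using c 1 2 3 unfolding K_nonneg_fin_def
    by (cases "m = 0"; cases "even m") auto
qed (auto simp: K_nonneg_fin_def)

lemma K_pos_fin_iff:
  assumes q: "q > 0"
  shows "s \<in> K_pos_fin q \<alpha> m \<longleftrightarrow> (\<forall>j\<le>m. s j \<in> carrier_mat q q) \<and>
    pd (Suc (m div 2) * q) (hankel q (\<lambda>j. emb (s j)) (m div 2)) \<and>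
    (m \<noteq> 0 \<longrightarrow> pd (Suc ((m - 1) div 2) * q) (hankel q (alpha_shift \<alpha> (\<lambda>j. emb (s j))) ((m - 1) div 2)))"
proof (cases "\<forall>j\<le>m. s j \<in> carrier_mat q q")
  case c: True
  have 1: "pos_hermitian (block_hankel q s (m div 2)) \<longleftrightarrow> pd (Suc (m div 2) * q) (hankel q (\<lambda>j. emb (s j)) (m div 2))"
    using c by (subst pos_hermitian_emb[OF block_hankel_carrier], subst emb_block_hankel[OF q]) auto
  have 2: "pos_hermitian (block_hankel q (shifted_seq \<alpha> s) ((m - 1) div 2))
      \<longleftrightarrow> pd (Suc ((m - 1) div 2) * q) (hankel q (alpha_shift \<alpha> (\<lambda>j. emb (s j))) ((m - 1) div 2))" if "m \<noteq> 0"
  proof -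
    have "Suc (2 * ((m - 1) div 2)) \<le> m" using that by presburger
    then show ?thesis
      using c by (subst pos_hermitian_emb[OF block_hankel_carrier], subst emb_block_hankel_shifted[OF q]) auto
  qed
  have s0: "s 0 \<in> carrier_mat q q" using c by simp
  have 3: "pos_hermitian (s 0) \<longleftrightarrow> pd q (hankel q (\<lambda>j. emb (s j)) 0)"
    using pos_hermitian_emb[OF s0] hankel_0[of q "\<lambda>j. emb (s j)"] supp_emb[OF s0] by simp
  have "m div 2 - 1 = (m - 1) div 2" if "even m" using that by presburger
  moreover have "m div 2 = (m - 1) div 2" if "odd m" using that by presburger
  ultimately show ?thesis using c 1 2 3 unfolding K_pos_fin_def
    by (cases "m = 0"; cases "even m") auto
qed (auto simp: K_pos_fin_def)

text \<open>Up to \<open>2 * (m div 2)\<close> the entries are Hermitian as entries of the first Hankel matrix. For odd \<open>m\<close> the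
last entry occurs only in the shifted one.\<close>

lemma hermitian_entries:
  assumes c: "\<And>j. j \<le> m \<Longrightarrow> supp q q (v j)"
    and 1: "star (hankel q v (m div 2)) = hankel q v (m div 2)"
    and 2: "m \<noteq> 0 \<Longrightarrow> star (hankel q (alpha_shift \<alpha> v) ((m - 1) div 2)) = hankel q (alpha_shift \<alpha> v) ((m - 1) div 2)"
    and j: "j \<le> m"
  shows "star (v j) = v j"
proof -
  have *: "star (v i) = v i" if "i \<le> 2 * (m div 2)" for i
    using 1 that c by (subst (asm) hankel_hermitian_iff) auto
  show ?thesis
  proof (cases "j \<le> 2 * (m div 2)")
    case False
    then have jm: "m \<noteq> 0" "j = Suc (m - 1)" "m - 1 \<le> 2 * (m div 2)" "m - 1 \<le> 2 * ((m - 1) div 2)" "2 * ((m - 1) div 2) \<le> m - 1"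
      using j by presburger+
    have "\<forall>i\<le>2 * ((m - 1) div 2). star (alpha_shift \<alpha> v i) = alpha_shift \<alpha> v i"
      using 2[OF jm(1)] jm c by (subst (asm) hankel_hermitian_iff) (auto simp: alpha_shift_def)
    then have "star (alpha_shift \<alpha> v (m - 1)) = alpha_shift \<alpha> v (m - 1)" using jm by blast
    then show ?thesis using *[of "m - 1"] jm by (simp add: alpha_shift_def)
  qed (use * in simp)
qed

lemma blk_congruence:
  assumes q: "q > 0" and F: "\<And>j a. supp q q (F j a)" and v: "\<And>j. j \<le> 2 * p \<Longrightarrow> supp q q (v j)"
  shows "blk q n (Suc p) F * hankel q v p * star (blk q n (Suc p) F) =
    blk q n n (\<lambda>j k. \<Sum>a\<le>p. \<Sum>b\<le>p. F j a * v (a + b) * star (F k b))"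
proof -
  have "blk q n (Suc p) F * hankel q v p * star (blk q n (Suc p) F)
    = blk q n n (\<lambda>j k. \<Sum>b<Suc p. (\<Sum>a<Suc p. F j a * v (a + b)) * star (F k b))"
    unfolding hankel_def star_blk using F v
    by (subst blk_mult[OF q], simp, subst blk_mult[OF q]) (auto intro!: supp_sum supp_mult[of q q _ q q] simp del: sum.lessThan_Suc)
  also have "\<dots> = blk q n n (\<lambda>j k. \<Sum>a\<le>p. \<Sum>b\<le>p. F j a * v (a + b) * star (F k b))"
    unfolding lessThan_Suc_atMost sum_distrib_right by (subst sum.swap) simp
  finally show ?thesis .
qed

text \<open>The lemma \<open>hankel_range\<close> says nothing about the last entry, which is in general not controlled by the
first. If the Hankel matrix has a kernel column ending in the identity, it is: multiplied by \<open>X\<close> and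
with its last block removed, the kernel column becomes isotropic.\<close>

lemma degenerate_last:
  assumes q: "q > 0" and f: "\<And>j. j \<le> 2 * n \<Longrightarrow> supp q q (f j)" and psd: "psd (hankel q f n)"
    and Y: "\<And>b. supp q q (Y b)" "Y n = eye q" "\<And>a. a \<le> n \<Longrightarrow> (\<Sum>b\<le>n. f (a + b) * Y b) = 0"
    and X: "supp q q X" "\<And>j. j < 2 * n \<Longrightarrow> f j * X = 0"
  shows "f (2 * n) * X = 0"
proof -
  define Z where "Z b = (if b = n then 0 else Y b * X)" for b
  have sum: "(\<Sum>b\<le>n. f (a + b) * Z b) = - (f (a + n) * X)" if "a \<le> n" for a
  proof -
    have "(\<Sum>b\<le>n. f (a + b) * Z b) = (\<Sum>b<n. f (a + b) * Y b) * X"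
      unfolding lessThan_Suc_atMost[symmetric] by (simp add: Z_def sum_distrib_right mult.assoc)
    also have "(\<Sum>b<n. f (a + b) * Y b) = - f (a + n)"
    proof -
      have "f (a + n) * eye q = f (a + n)" using f[of "a + n"] that by (intro mult_eye) auto
      then have "(\<Sum>b<n. f (a + b) * Y b) + f (a + n) = 0"
        using Y(3)[OF that] unfolding lessThan_Suc_atMost[symmetric] by (simp add: Y(2))
      then show ?thesis by (simp add: add_eq_0_iff2)
    qed
    finally show ?thesis by simp
  qed
  have "(\<Sum>b\<le>n. f (n + b) * Z b) = 0"
  proof (rule hankel_kernel[OF q f psd])
    show "(\<Sum>a\<le>n. star (Z a) * (\<Sum>b\<le>n. f (a + b) * Z b)) = 0"
    proof (rule sum.neutral, intro ballI)
      fix a assume "a \<in> {..n}"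
      then show "star (Z a) * (\<Sum>b\<le>n. f (a + b) * Z b) = 0"
        using X(2)[of "a + n"] by (cases "a = n") (simp_all add: sum, simp add: Z_def)
    qed
    show "supp q q (Z b)" for b using supp_mult[OF Y(1) X(1)] by (simp add: Z_def)
  qed simp_all
  then show ?thesis using sum[of n] by (simp add: mult_2)
qed

section \<open>The first Schur transform of a matrix sequence\<close>

text \<open>The passage from a matrix sequence, of which only the entries with index at most \<open>N\<close> matter, to the
compressed sequence \<open>\<sigma>\<close>. Cutting \<open>\<sigma>\<close> off at \<open>N\<close> makes it Hermitian everywhere.\<close>

locale schur_data =
  fixes q :: nat and \<alpha> :: real and s :: mat_seq and N :: nat
  assumes q: "q > 0" and carrier: "\<And>j. j \<le> N \<Longrightarrow> s j \<in> carrier_mat q q"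
    and herm_s: "\<And>j. j \<le> N \<Longrightarrow> star (emb (s j)) = emb (s j)"
begin

abbreviation v :: "nat \<Rightarrow> finmat" where "v j \<equiv> emb (s j)"

definition d :: finmat where "d = emb (moore_penrose (s 0))"
definition P :: finmat where "P = v 0 * d"
definition \<sigma> :: "nat \<Rightarrow> finmat" where "\<sigma> j = (if j \<le> N then P * v j * P else 0)"

lemma supp_v: "j \<le> N \<Longrightarrow> supp q q (v j)"
  using carrier by simp

lemma mp_carrier: "moore_penrose (s 0) \<in> carrier_mat q q" and mp: "mp_inverse (v 0) d"
  using moore_penrose_hermitian[of "s 0" q] carrier herm_s by (auto simp: d_def)

lemma range_projection: "P * v 0 = v 0" "v 0 * P = v 0" "star P = P" "d * v 0 = P" "P * d = d" "star d = d" "P * P = P"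
proof -
  note c = mp_inverse_hermitian_commute[OF herm_s mp, OF le0]
  note m = mp[unfolded mp_inverse_def]
  show "P * v 0 = v 0" "star P = P" "d * v 0 = P" "star d = d" using c m by (simp_all add: P_def)
  show "P * d = d" "v 0 * P = v 0" "P * P = P" using c m unfolding P_def by (metis mult.assoc)+
qed

lemma supp_P: "supp q q P"
  unfolding P_def d_def using supp_v[of 0] mp_carrier by (intro supp_mult[of q q _ q q]) auto

sublocale schur_step q \<alpha> \<sigma> d P
proof
  show "star (\<sigma> j) = \<sigma> j" "P * \<sigma> j = \<sigma> j" for j
    using herm_s range_projection by (simp_all add: \<sigma>_def star_mult mult.assoc) (simp add: mult.assoc[symmetric] range_projection)
  show "supp q q (\<sigma> j)" for j
    using supp_mult[OF supp_mult[OF supp_P supp_v] supp_P] by (simp add: \<sigma>_def)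
  show "supp q q d" unfolding d_def using mp_carrier by simp
  show "\<sigma> 0 * d = P" by (simp add: \<sigma>_def range_projection mult.assoc) (simp add: P_def)
  show "d * \<sigma> 0 = P" by (simp add: \<sigma>_def range_projection mult.assoc)
qed (simp_all add: range_projection)

lemma \<sigma>_0: "\<sigma> 0 = v 0"
  by (simp add: \<sigma>_def range_projection mult.assoc)

lemma u_compress: "Suc j \<le> N \<Longrightarrow> u (Suc j) = P * alpha_shift \<alpha> v j * P"
  by (simp add: u_Suc \<sigma>_def alpha_shift_def right_diff_distrib left_diff_distrib)

lemma plus_transform_carrier: "j \<le> N \<Longrightarrow> plus_transform \<alpha> s j \<in> carrier_mat q q"
  using carrier by (cases j) (auto simp: plus_transform_def)

text \<open>Compression commutes with the \<open>[+,\<alpha>]\<close>-transform.\<close>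

lemma emb_plus_transform: "j \<le> N \<Longrightarrow> P * emb (plus_transform \<alpha> s j) * P = u j"
proof (cases j)
  case (Suc i)
  assume "j \<le> N"
  then show ?thesis using carrier[of i] carrier[of j] Suc
    by (simp add: plus_transform_def emb_add[of _ q q] emb_smult[of "- \<alpha>", simplified] u_compress alpha_shift_def)
qed (simp add: plus_transform_def u_0 \<sigma>_def)

lemma emb_foldr_sum:
  assumes "\<And>l. l < n \<Longrightarrow> f l \<in> carrier_mat q q"
  shows "foldr (+) (map f [0..<n]) (0\<^sub>m q q) \<in> carrier_mat q q \<and>
    emb (foldr (+) (map f [0..<n]) (0\<^sub>m q q)) = (\<Sum>l<n. emb (f l))"
proof -
  have "foldr (+) (map f xs) (0\<^sub>m q q) \<in> carrier_mat q q \<and>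
    emb (foldr (+) (map f xs) (0\<^sub>m q q)) = sum_list (map (\<lambda>l. emb (f l)) xs)" if "set xs \<subseteq> {..<n}" for xs
    using that assms by (induction xs) (auto simp: emb_add[of _ q q])
  from this[of "[0..<n]"] show ?thesis
    by (auto simp: interv_sum_list_conv_sum_set_nat lessThan_atLeast0)
qed

text \<open>In the recursion every entry of the \<open>[+,\<alpha>]\<close>-transform stands between a factor \<open>d = d * P\<close> and a factor
\<open>w l = P * w l\<close>. Hence the reciprocal sequence, and with it the Schur transform, depends only on the
compressed entries.\<close>

lemma reciprocal_seq_emb:
  "j \<le> N \<Longrightarrow> reciprocal_seq q (plus_transform \<alpha> s) j \<in> carrier_mat q q \<and>
    emb (reciprocal_seq q (plus_transform \<alpha> s) j) = w j"
proof (induction j rule: less_induct)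
  case (less j)
  show ?case
  proof (cases j)
    case 0
    moreover have "w 0 = d" by (simp add: w_def)
    ultimately show ?thesis using mp_carrier by (simp add: plus_transform_def d_def[symmetric])
  next
    case (Suc i)
    let ?R = "reciprocal_seq q (plus_transform \<alpha> s)" and ?u = "plus_transform \<alpha> s"
    have IH: "?R l \<in> carrier_mat q q" "emb (?R l) = w l" if "l \<le> i" for l
      using less that Suc by auto
    have uc: "?u (Suc i - l) \<in> carrier_mat q q" for l
      using less.prems Suc by (intro plus_transform_carrier) auto
    have c: "?u (Suc i - l) * ?R l \<in> carrier_mat q q" if "l < Suc i" for l
      using uc[of l] IH[of l] that by auto
    define F where "F = foldr (+) (map (\<lambda>l. ?u (Suc i - l) * ?R l) [0..<Suc i]) (0\<^sub>m q q)"
    have F: "F \<in> carrier_mat q q" "emb F = (\<Sum>l<Suc i. emb (?u (Suc i - l) * ?R l))"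
      unfolding F_def using emb_foldr_sum[of "Suc i" "\<lambda>l. ?u (Suc i - l) * ?R l"] c by auto
    have R: "?R (Suc i) = - (moore_penrose (s 0) * F)"
      by (simp add: F_def plus_transform_def del: upt_Suc)
    have "d * emb F = d * (\<Sum>l\<le>i. u (Suc i - l) * w l)"
      unfolding F(2) lessThan_Suc_atMost sum_distrib_left
    proof (intro sum.cong refl)
      fix l assume "l \<in> {..i}"
      then have l: "l \<le> i" by simp
      have "d * emb (?u (Suc i - l) * ?R l) = d * (emb (?u (Suc i - l)) * w l)"
        using emb_mult[OF uc IH(1)[OF l]] IH(2)[OF l] by simp
      also have "\<dots> = (d * P) * (emb (?u (Suc i - l)) * (P * w l))" by (simp only: d_P P_w)
      also have "\<dots> = d * ((P * emb (?u (Suc i - l)) * P) * w l)" by (simp only: mult.assoc)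
      also have "\<dots> = d * (u (Suc i - l) * w l)"
        using less.prems Suc by (subst emb_plus_transform) auto
      finally show "d * emb (?u (Suc i - l) * ?R l) = d * (u (Suc i - l) * w l)" .
    qed
    moreover have w_Suc: "w (Suc i) = - (d * (\<Sum>l\<le>i. u (Suc i - l) * w l))"
      by (simp add: w_def)
    ultimately have "emb (?R (Suc i)) = w (Suc i)"
      unfolding R emb_uminus using emb_mult[OF mp_carrier F(1)] by (simp add: w_Suc d_def[symmetric])
    then show ?thesis using R F(1) mp_carrier Suc by (metis mult_carrier_mat uminus_carrier_iff_mat)
  qed
qed

lemma schur_transform_emb:
  assumes "j < N"
  shows "schur_transform q \<alpha> s j \<in> carrier_mat q q" "emb (schur_transform q \<alpha> s j) = t j"
proof -
  have R: "reciprocal_seq q (plus_transform \<alpha> s) (Suc j) \<in> carrier_mat q q"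
    "emb (reciprocal_seq q (plus_transform \<alpha> s) (Suc j)) = w (Suc j)"
    using reciprocal_seq_emb[of "Suc j"] assms by auto
  have s0: "s 0 \<in> carrier_mat q q" using carrier by simp
  show "schur_transform q \<alpha> s j \<in> carrier_mat q q"
    unfolding schur_transform_def using s0 R by auto
  show "emb (schur_transform q \<alpha> s j) = t j"
    unfolding schur_transform_def emb_uminus t_def \<sigma>_0
    using emb_mult[OF mult_carrier_mat[OF s0 R(1)] s0] emb_mult[OF s0 R(1)] R(2) by (simp del: reciprocal_seq.simps)
qed

text \<open>The two congruences carry the theorem. The factors absorb \<open>P\<close>, so they may be written with the original
sequence instead of the compressed one.\<close>

lemma hankel_t:
  assumes n: "Suc (2 * n) \<le> N"
  shows "hankel q t n = blk q (Suc n) (Suc n) A * hankel q (alpha_shift \<alpha> v) n * star (blk q (Suc n) (Suc n) A)"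
proof -
  have "A j a * alpha_shift \<alpha> v i * star (A k b) = A j a * u (Suc i) * star (A k b)" if "i \<le> 2 * n" for i j k a b
  proof -
    have "A j a * alpha_shift \<alpha> v i * star (A k b) = (A j a * P) * alpha_shift \<alpha> v i * star (A k b * P)"
      by (simp only: A_P)
    also have "\<dots> = A j a * (P * alpha_shift \<alpha> v i * P) * star (A k b)"
      by (simp add: star_mult range_projection mult.assoc)
    finally show ?thesis using u_compress[of i] that n by simp
  qed
  then have "blk q (Suc n) (Suc n) A * hankel q (alpha_shift \<alpha> v) n * star (blk q (Suc n) (Suc n) A)
    = blk q (Suc n) (Suc n) (\<lambda>j k. \<Sum>a\<le>n. \<Sum>b\<le>n. A j a * u (Suc (a + b)) * star (A k b))"
    using n supp_A supp_v by (subst blk_congruence[OF q]) (auto simp: alpha_shift_def intro!: blk_cong sum.cong)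
  also have "\<dots> = hankel q t n"
    unfolding hankel_def by (intro blk_cong t_congruence[symmetric]) auto
  finally show ?thesis ..
qed

lemma hankel_t_shifted:
  assumes n: "2 * Suc n \<le> N"
  shows "hankel q (alpha_shift \<alpha> t) n = blk q (Suc n) (Suc (Suc n)) B * hankel q v (Suc n) * star (blk q (Suc n) (Suc (Suc n)) B)"
proof -
  have "B j a * v i * star (B k b) = B j a * \<sigma> i * star (B k b)" if "i \<le> 2 * Suc n" for i j k a b
  proof -
    have "B j a * v i * star (B k b) = (B j a * P) * v i * star (B k b * P)"
      by (simp only: B_P)
    also have "\<dots> = B j a * (P * v i * P) * star (B k b)"
      by (simp add: star_mult range_projection mult.assoc)
    finally show ?thesis using that n by (simp add: \<sigma>_def)
  qed
  then have "blk q (Suc n) (Suc (Suc n)) B * hankel q v (Suc n) * star (blk q (Suc n) (Suc (Suc n)) B)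
    = blk q (Suc n) (Suc n) (\<lambda>j k. \<Sum>a\<le>Suc n. \<Sum>b\<le>Suc n. B j a * \<sigma> (a + b) * star (B k b))"
    using n supp_B supp_v by (subst blk_congruence[OF q]) (auto intro!: blk_cong sum.cong simp del: sum.atMost_Suc)
  also have "\<dots> = hankel q (alpha_shift \<alpha> t) n"
    unfolding hankel_def alpha_shift_def by (intro blk_cong t_shifted_congruence[symmetric]) auto
  finally show ?thesis ..
qed

lemma hankel_schur:
  assumes "2 * n < N"
  shows "hankel q (\<lambda>j. emb (schur_transform q \<alpha> s j)) n = hankel q t n"
  using assms by (intro hankel_cong schur_transform_emb) auto

lemma hankel_schur_shifted:
  assumes "Suc (2 * n) < N"
  shows "hankel q (alpha_shift \<alpha> (\<lambda>j. emb (schur_transform q \<alpha> s j))) n = hankel q (alpha_shift \<alpha> t) n"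
  using assms by (intro hankel_cong) (simp add: alpha_shift_def schur_transform_emb)

text \<open>The first entry is a compression of the Hankel matrix, hence itself definite and injective.\<close>

lemma P_eq_eye:
  assumes n: "2 * n \<le> N" and pd: "pd (Suc n * q) (hankel q v n)"
  shows "P = eye q"
proof -
  define E where "E = blk q 1 (Suc n) (\<lambda>_ b. if b = 0 then eye q else 0)"
  have E: "supp (1 * q) (Suc n * q) E" unfolding E_def by (rule supp_blk)
  have "E * star E = blk q 1 1 (\<lambda>_ _. eye q)"
  proof -
    have "(\<Sum>b<Suc n. (if b = 0 then eye q else 0) * star (if b = 0 then eye q else 0)) = (\<Sum>b<Suc n. if b = 0 then eye q else 0)"
      by (intro sum.cong) (auto simp: eye_mult[OF supp_eye])
    also have "\<dots> = eye q" by (subst sum.delta) auto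
    finally show ?thesis unfolding E_def star_blk by (subst blk_mult[OF q]) (auto simp del: sum.lessThan_Suc)
  qed
  also have "\<dots> = blk q 1 1 (\<lambda>j k. if j = k then eye q else 0)" by (rule blk_cong) simp
  also have "\<dots> = eye (1 * q)" by (rule blk_eye[OF q])
  finally have EE: "E * star E = eye (1 * q)" .
  have "E * hankel q v n * star E = blk q 1 1 (\<lambda>j k. \<Sum>a\<le>n. \<Sum>b\<le>n. (if a = 0 then eye q else 0) * v (a + b) * star (if b = 0 then eye q else 0))"
    unfolding E_def using supp_v n by (subst blk_congruence[OF q]) auto
  also have "\<dots> = hankel q v 0"
  proof -
    have "(\<Sum>a\<le>n. \<Sum>b\<le>n. (if a = 0 then eye q else 0) * v (a + b) * star (if b = 0 then eye q else 0))
      = (\<Sum>a\<le>n. if a = 0 then v 0 else 0)"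
    proof (intro sum.cong refl)
      fix a
      have "(\<Sum>b\<le>n. (if a = 0 then eye q else 0) * v (a + b) * star (if b = 0 then eye q else 0))
        = (\<Sum>b\<le>n. if b = 0 then (if a = 0 then v 0 else 0) else 0)"
        using eye_mult[OF supp_v[OF le0]] mult_eye[OF supp_v[OF le0]] by (intro sum.cong) auto
      then show "(\<Sum>b\<le>n. (if a = 0 then eye q else 0) * v (a + b) * star (if b = 0 then eye q else 0)) = (if a = 0 then v 0 else 0)"
        by simp
    qed
    then show ?thesis unfolding hankel_def One_nat_def by (intro blk_cong) simp
  qed
  also have "\<dots> = v 0" by (rule hankel_0) (simp add: supp_v)
  finally have "pd (1 * q) (v 0)" using pd_congruence[OF pd EE E] by simp
  moreover have "supp (1 * q) q (eye q - P)" using supp_P by simp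
  moreover have "v 0 * (eye q - P) = 0" using mult_eye[OF supp_v[OF le0]] by (simp add: right_diff_distrib range_projection)
  ultimately have "eye q - P = 0" by (rule pd_kernel)
  then show ?thesis by simp
qed

lemma pd_hankel_t:
  assumes n: "Suc (2 * n) \<le> N" and P: "P = eye q" and pd: "pd (Suc n * q) (hankel q (alpha_shift \<alpha> v) n)"
  shows "pd (Suc n * q) (hankel q t n)"
  unfolding hankel_t[OF n]
proof (rule pd_congruence[OF pd])
  show "blk q (Suc n) (Suc n) (\<lambda>k b. d * (if k \<le> b then u (b - k) else 0)) * star (blk q (Suc n) (Suc n) A) = eye (Suc n * q)"
  proof -
    have "supp q q (d * (if k \<le> b then u (b - k) else 0))" for k b
      using supp_mult[OF supp_d supp_u] by auto
    then have "blk q (Suc n) (Suc n) (\<lambda>k b. d * (if k \<le> b then u (b - k) else 0)) * star (blk q (Suc n) (Suc n) A)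
      = blk q (Suc n) (Suc n) (\<lambda>k j. \<Sum>b\<le>n. (d * (if k \<le> b then u (b - k) else 0)) * star (A j b))"
      unfolding star_blk by (subst blk_mult[OF q]) (auto simp only: lessThan_Suc_atMost)
    also have "\<dots> = blk q (Suc n) (Suc n) (\<lambda>k j. if k = j then eye q else 0)"
      by (intro blk_cong) (simp only: A_left_inverse less_Suc_eq_le P)
    finally show ?thesis by (simp only: blk_eye[OF q])
  qed
qed (rule supp_blk)

lemma pd_hankel_t_shifted:
  assumes n: "2 * Suc n \<le> N" and P: "P = eye q" and pd: "pd (Suc (Suc n) * q) (hankel q v (Suc n))"
  shows "pd (Suc n * q) (hankel q (alpha_shift \<alpha> t) n)"
  unfolding hankel_t_shifted[OF n]
proof (rule pd_congruence[OF pd])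
  show "blk q (Suc n) (Suc (Suc n)) (\<lambda>k b. d * (if Suc k \<le> b then \<sigma> (b - Suc k) else 0)) * star (blk q (Suc n) (Suc (Suc n)) B) = eye (Suc n * q)"
  proof -
    have "supp q q (d * (if Suc k \<le> b then \<sigma> (b - Suc k) else 0))" for k b
      using supp_mult[OF supp_d supp_\<sigma>] by auto
    then have "blk q (Suc n) (Suc (Suc n)) (\<lambda>k b. d * (if Suc k \<le> b then \<sigma> (b - Suc k) else 0)) * star (blk q (Suc n) (Suc (Suc n)) B)
      = blk q (Suc n) (Suc n) (\<lambda>k j. \<Sum>b\<le>Suc n. (d * (if Suc k \<le> b then \<sigma> (b - Suc k) else 0)) * star (B j b))"
      unfolding star_blk by (subst blk_mult[OF q]) (auto simp only: lessThan_Suc_atMost)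
    also have "\<dots> = blk q (Suc n) (Suc n) (\<lambda>k j. if k = j then eye q else 0)"
      by (intro blk_cong) (simp only: B_left_inverse less_Suc_eq_le P)
    finally show ?thesis by (simp only: blk_eye[OF q])
  qed
qed (rule supp_blk)

lemma compress_eq:
  assumes "supp q q X" "star X = X" "X * (eye q - P) = 0"
  shows "P * X * P = X"
proof -
  have "X * P = X" using assms mult_eye[OF assms(1)] by (simp add: right_diff_distrib)
  moreover from this have "P * X = X" by (metis assms(2) star_mult range_projection(3))
  ultimately show ?thesis by simp
qed

text \<open>In the degenerate case compression changes nothing: all entries that occur vanish on the complement of
the range of \<open>s 0\<close>, the last one by \<open>degenerate_last\<close>. The kernel columns of the Hankel matrices of \<open>s\<close> can then
be transported.\<close>

lemma v_complement:
  assumes "psd (hankel q v n)" "2 * n \<le> N" "j < 2 * n"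
  shows "v j * (eye q - P) = 0"
proof (rule hankel_range[OF q _ assms(1) _ _ assms(3)])
  show "v 0 * (eye q - P) = 0" using mult_eye[OF supp_v[OF le0]] by (simp add: right_diff_distrib range_projection)
qed (use supp_v supp_P assms in auto)

lemma L_schur_eq_0:
  assumes n: "Suc (2 * n) \<le> N" and psd: "psd (hankel q v n)" "psd (hankel q (alpha_shift \<alpha> v) n)"
    and L: "L_mat q (shifted_seq \<alpha> s) n = 0\<^sub>m q q"
  shows "L_mat q (schur_transform q \<alpha> s) n = 0\<^sub>m q q"
proof -
  define f where "f = alpha_shift \<alpha> v"
  have sf: "supp q q (f j)" if "j \<le> 2 * n" for j using that n supp_v by (simp add: f_def alpha_shift_def)
  have hf: "star (f j) = f j" if "j \<le> 2 * n" for j using that n herm_s by (simp add: f_def alpha_shift_def)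
  have emb_f: "emb (shifted_seq \<alpha> s j) = f j" if "j \<le> 2 * n" for j
    unfolding f_def using that n carrier by (intro emb_shifted_seq[of _ _ q]) auto
  have hank: "hankel q (\<lambda>j. emb (shifted_seq \<alpha> s j)) n = hankel q f n"
    by (rule hankel_cong) (rule emb_f)
  have sc: "shifted_seq \<alpha> s j \<in> carrier_mat q q" if "j \<le> 2 * n" for j
    using that n carrier by (intro shifted_seq_carrier) auto
  have "psd (hankel q (\<lambda>j. emb (shifted_seq \<alpha> s j)) n)" using psd(2) by (simp add: hank f_def)
  from iffD1[OF emb_L_mat[OF q sc this] L] obtain Y where Y: "\<And>b. supp q q (Y b)" "Y n = eye q" "\<And>a. a \<le> n \<Longrightarrow> (\<Sum>b\<le>n. emb (shifted_seq \<alpha> s (a + b)) * Y b) = 0"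
    by blast
  have Y3: "(\<Sum>b\<le>n. f (a + b) * Y b) = 0" if "a \<le> n" for a
    using Y(3)[OF that] that emb_f by simp
  have sX: "supp q q (eye q - P)" using supp_P by simp
  have fX: "f j * (eye q - P) = 0" if j: "j < 2 * n" for j
  proof (rule hankel_range[OF q sf _ sX _ j])
    have "0 < 2 * n" "1 < 2 * n" "2 * n \<le> N" using j n by presburger+
    then have "v 0 * (eye q - P) = 0" "v 1 * (eye q - P) = 0"
      using v_complement[OF psd(1)] by blast+
    then show "f 0 * (eye q - P) = 0" by (simp add: f_def alpha_shift_def left_diff_distrib)
  qed (use psd f_def in auto)
  have "f (2 * n) * (eye q - P) = 0"
    by (rule degenerate_last[OF q sf _ Y(1,2) Y3 sX fX]) (use psd f_def in auto)
  then have "P * f j * P = f j" if "j \<le> 2 * n" for j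
    using fX[of j] that sf hf by (intro compress_eq) (auto simp: le_less)
  then have u: "u (Suc j) = f j" if "j \<le> 2 * n" for j
    using u_compress[of j] n that by (simp add: f_def)
  have "\<exists>Y. (\<forall>b. supp q q (Y b)) \<and> Y n = eye q \<and> (\<forall>a\<le>n. (\<Sum>b\<le>n. t (a + b) * Y b) = 0)"
  proof (rule t_degenerate[where Y = Y])
    fix a assume a: "a \<le> n"
    have "(\<Sum>b\<le>n. u (Suc (a + b)) * Y b) = (\<Sum>b\<le>n. f (a + b) * Y b)"
      using a by (intro sum.cong) (auto simp: u)
    then show "(\<Sum>b\<le>n. u (Suc (a + b)) * Y b) = 0" using Y3[OF a] by simp
  qed (rule Y)+
  then have *: "\<exists>Y. (\<forall>b. supp q q (Y b)) \<and> Y n = eye q \<and> (\<forall>a\<le>n. (\<Sum>b\<le>n. emb (schur_transform q \<alpha> s (a + b)) * Y b) = 0)"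
    using n by (auto simp: schur_transform_emb)
  have "psd (hankel q (\<lambda>j. emb (schur_transform q \<alpha> s j)) n)"
    using n psd_congruence[OF psd(2)] by (simp add: hankel_schur hankel_t)
  with * show ?thesis
    using n by (subst emb_L_mat[OF q]) (auto intro: schur_transform_emb)
qed

lemma L_schur_shifted_eq_0:
  assumes n: "2 * Suc n \<le> N" and psd: "psd (hankel q v (Suc n))"
    and L: "L_mat q s (Suc n) = 0\<^sub>m q q"
  shows "L_mat q (shifted_seq \<alpha> (schur_transform q \<alpha> s)) n = 0\<^sub>m q q"
proof -
  have sc: "s j \<in> carrier_mat q q" if "j \<le> 2 * Suc n" for j
    using that n carrier by auto
  from iffD1[OF emb_L_mat[OF q sc psd] L] obtain Y where Y: "\<And>b. supp q q (Y b)" "Y (Suc n) = eye q" "\<And>a. a \<le> Suc n \<Longrightarrow> (\<Sum>b\<le>Suc n. v (a + b) * Y b) = 0"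
    by blast
  have sX: "supp q q (eye q - P)" using supp_P by simp
  have sv: "supp q q (v j)" if "j \<le> 2 * Suc n" for j using that n supp_v by simp
  have vX: "v j * (eye q - P) = 0" if "j < 2 * Suc n" for j
    using v_complement[OF psd n that] .
  have "v (2 * Suc n) * (eye q - P) = 0"
    by (rule degenerate_last[OF q sv psd Y sX vX])
  then have "P * v j * P = v j" if "j \<le> 2 * Suc n" for j
    using vX[of j] that sv herm_s[of j] n by (intro compress_eq) (auto simp: le_less)
  then have \<sigma>: "\<sigma> j = v j" if "j \<le> 2 * Suc n" for j
    using n that by (simp add: \<sigma>_def)
  have "\<exists>Y. (\<forall>b. supp q q (Y b)) \<and> Y n = eye q \<and> (\<forall>a\<le>n. (\<Sum>b\<le>n. (t (Suc (a + b)) - \<alpha> *\<^sub>R t (a + b)) * Y b) = 0)"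
  proof (rule t_shifted_degenerate[where Y = Y])
    fix a assume a: "a \<le> Suc n"
    have "(\<Sum>b\<le>Suc n. \<sigma> (a + b) * Y b) = (\<Sum>b\<le>Suc n. v (a + b) * Y b)"
      using a by (intro sum.cong) (auto simp: \<sigma>)
    then show "(\<Sum>b\<le>Suc n. \<sigma> (a + b) * Y b) = 0" using Y(3)[OF a] by simp
  qed (rule Y)+
  moreover have emb: "emb (shifted_seq \<alpha> (schur_transform q \<alpha> s) j) = t (Suc j) - \<alpha> *\<^sub>R t j" if "j \<le> 2 * n" for j
    using n that by (subst emb_shifted_seq[of _ _ q]) (auto simp: alpha_shift_def schur_transform_emb)
  ultimately have *: "\<exists>Y. (\<forall>b. supp q q (Y b)) \<and> Y n = eye q \<and> (\<forall>a\<le>n. (\<Sum>b\<le>n. emb (shifted_seq \<alpha> (schur_transform q \<alpha> s) (a + b)) * Y b) = 0)"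
    by auto
  have "psd (hankel q (alpha_shift \<alpha> t) n)"
    using psd_congruence[OF psd] by (simp add: hankel_t_shifted[OF n])
  also have "hankel q (alpha_shift \<alpha> t) n = hankel q (\<lambda>j. emb (shifted_seq \<alpha> (schur_transform q \<alpha> s) j)) n"
    by (intro hankel_cong) (simp add: emb alpha_shift_def)
  finally have "psd (hankel q (\<lambda>j. emb (shifted_seq \<alpha> (schur_transform q \<alpha> s) j)) n)" .
  with * show ?thesis
    using n by (subst emb_L_mat[OF q]) (auto intro!: shifted_seq_carrier schur_transform_emb)
qed

end

section \<open>Invariance of the classes\<close>

lemma schur_data_of_K_nonneg:
  assumes "q > 0" "s \<in> K_nonneg_fin q \<alpha> N" shows "schur_data q s N"
proof
  show "j \<le> N \<Longrightarrow> star (emb (s j)) = emb (s j)" for j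
    using assms by (intro hermitian_entries[of N q "\<lambda>j. emb (s j)" \<alpha>]) (auto simp: K_nonneg_fin_iff psd_def)
qed (use assms in \<open>auto simp: K_nonneg_fin_iff\<close>)

lemma schur_data_of_K_pos:
  assumes "q > 0" "s \<in> K_pos_fin q \<alpha> N" shows "schur_data q s N"
proof
  show "j \<le> N \<Longrightarrow> star (emb (s j)) = emb (s j)" for j
    using assms by (intro hermitian_entries[of N q "\<lambda>j. emb (s j)" \<alpha>]) (auto simp: K_pos_fin_iff pd_def)
qed (use assms in \<open>auto simp: K_pos_fin_iff\<close>)

lemma schur_K_nonneg_fin:
  assumes q: "q > 0" and s: "s \<in> K_nonneg_fin q \<alpha> (Suc m)"
  shows "schur_transform q \<alpha> s \<in> K_nonneg_fin q \<alpha> m"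
proof -
  interpret schur_data q \<alpha> s "Suc m" using schur_data_of_K_nonneg[OF q s] .
  note S = s[unfolded K_nonneg_fin_iff[OF q]]
  have 1: "psd (hankel q t (m div 2))"
    using S psd_congruence by (simp add: hankel_t)
  have 2: "psd (hankel q (alpha_shift \<alpha> t) ((m - 1) div 2))" if "m \<noteq> 0"
  proof -
    have e: "Suc m div 2 = Suc ((m - 1) div 2)" "2 * Suc ((m - 1) div 2) \<le> Suc m" using that by presburger+
    then show ?thesis using S psd_congruence by (simp only: hankel_t_shifted[OF e(2)])
  qed
  have "Suc (2 * ((m - 1) div 2)) < Suc m" if "m \<noteq> 0" using that by presburger
  then show ?thesis
    using 1 2 by (auto simp: K_nonneg_fin_iff[OF q] schur_transform_emb hankel_schur hankel_schur_shifted)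
qed

lemma schur_K_pos_fin:
  assumes q: "q > 0" and s: "s \<in> K_pos_fin q \<alpha> (Suc m)"
  shows "schur_transform q \<alpha> s \<in> K_pos_fin q \<alpha> m"
proof -
  interpret schur_data q \<alpha> s "Suc m" using schur_data_of_K_pos[OF q s] .
  note S = s[unfolded K_pos_fin_iff[OF q]]
  have P: "P = eye q" using S by (intro P_eq_eye[of "Suc m div 2"]) auto
  have 1: "pd (Suc (m div 2) * q) (hankel q t (m div 2))"
    using S by (intro pd_hankel_t P) auto
  have 2: "pd (Suc ((m - 1) div 2) * q) (hankel q (alpha_shift \<alpha> t) ((m - 1) div 2))" if "m \<noteq> 0"
  proof -
    have e: "Suc m div 2 = Suc ((m - 1) div 2)" "2 * Suc ((m - 1) div 2) \<le> Suc m" using that by presburger+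
    then show ?thesis using S by (intro pd_hankel_t_shifted P) simp_all
  qed
  have "Suc (2 * ((m - 1) div 2)) < Suc m" if "m \<noteq> 0" using that by presburger
  then show ?thesis
    using 1 2 by (auto simp: K_pos_fin_iff[OF q] schur_transform_emb hankel_schur hankel_schur_shifted)
qed

lemma schur_K_cd_fin:
  assumes q: "q > 0" and s: "s \<in> K_cd_fin q \<alpha> (Suc m)"
  shows "schur_transform q \<alpha> s \<in> K_cd_fin q \<alpha> m"
proof -
  have s': "s \<in> K_nonneg_fin q \<alpha> (Suc m)" using s by (simp add: K_cd_fin_def)
  interpret schur_data q \<alpha> s "Suc m" using schur_data_of_K_nonneg[OF q s'] .
  note S = s'[unfolded K_nonneg_fin_iff[OF q]]
  show ?thesis
  proof (cases "even m")
    case True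
    then have e: "Suc m div 2 = m div 2" by presburger
    have "L_mat q (schur_transform q \<alpha> s) (m div 2) = 0\<^sub>m q q"
      using S s True e by (intro L_schur_eq_0) (auto simp: K_cd_fin_def)
    then show ?thesis using schur_K_nonneg_fin[OF q s'] True by (simp add: K_cd_fin_def)
  next
    case False
    then have e: "Suc m div 2 = Suc (m div 2)" by presburger
    have "L_mat q (shifted_seq \<alpha> (schur_transform q \<alpha> s)) (m div 2) = 0\<^sub>m q q"
      using S s False e by (intro L_schur_shifted_eq_0) (auto simp: K_cd_fin_def)
    then show ?thesis using schur_K_nonneg_fin[OF q s'] False by (simp add: K_cd_fin_def)
  qed
qed

text \<open>For \<open>m = 0\<close> degeneracy means \<open>s 0 = 0\<close>, and the transform vanishes because of its outer factors \<open>s 0\<close>.\<close>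

lemma schur_K_cd_fin_0:
  assumes q: "q > 0" and s: "s \<in> K_cd_fin q \<alpha> 0"
  shows "schur_transform q \<alpha> s \<in> K_cd_fin q \<alpha> 0"
proof -
  have s0: "s 0 = 0\<^sub>m q q" using s by (simp add: K_cd_fin_def L_mat_def)
  have "moore_penrose (s 0) \<in> carrier_mat q q"
    using moore_penrose_hermitian[of "s 0" q] s0 by simp
  then have "reciprocal_seq q (plus_transform \<alpha> s) 1 \<in> carrier_mat q q"
    by (auto simp: plus_transform_def)
  then have T: "schur_transform q \<alpha> s 0 = 0\<^sub>m q q"
    unfolding schur_transform_def s0 One_nat_def
    by (simp del: reciprocal_seq.simps) (rule eq_matI; simp)
  have "nonneg_hermitian (0\<^sub>m q q)"
    by (subst nonneg_hermitian_emb[of _ q]) (auto simp: psd_def)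
  then show ?thesis by (simp add: K_cd_fin_def K_nonneg_fin_def L_mat_def T)
qed

lemma reciprocal_seq_cong:
  "(\<And>i. i \<le> j \<Longrightarrow> u i = u' i) \<Longrightarrow> reciprocal_seq q u j = reciprocal_seq q u' j"
proof (induction j rule: less_induct)
  case (less j)
  show ?case
  proof (cases j)
    case (Suc i)
    have "map (\<lambda>l. u (Suc i - l) * reciprocal_seq q u l) [0..<Suc i]
      = map (\<lambda>l. u' (Suc i - l) * reciprocal_seq q u' l) [0..<Suc i]"
      using less Suc by (intro map_cong refl arg_cong2[where f = "(*)"]) auto
    then show ?thesis unfolding Suc reciprocal_seq.simps by (simp only: less.prems[OF le0])
  qed (use less in simp)
qed

lemma schur_transform_cong:
  assumes "\<And>i. i \<le> Suc j \<Longrightarrow> s i = s' i"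
  shows "schur_transform q \<alpha> s j = schur_transform q \<alpha> s' j"
proof -
  have "reciprocal_seq q (plus_transform \<alpha> s) (Suc j) = reciprocal_seq q (plus_transform \<alpha> s') (Suc j)"
    using assms by (intro reciprocal_seq_cong) (auto simp: plus_transform_def split: nat.split)
  then show ?thesis using assms[of 0] by (simp add: schur_transform_def del: reciprocal_seq.simps)
qed

lemma K_nonneg_fin_cong:
  assumes q: "q > 0" and eq: "\<And>j. j \<le> m \<Longrightarrow> s j = s' j" and s: "s \<in> K_nonneg_fin q \<alpha> m"
  shows "s' \<in> K_nonneg_fin q \<alpha> m"
proof -
  have "hankel q (\<lambda>j. emb (s j)) (m div 2) = hankel q (\<lambda>j. emb (s' j)) (m div 2)"
    by (intro hankel_cong) (simp add: eq)
  moreover have "hankel q (alpha_shift \<alpha> (\<lambda>j. emb (s j))) ((m - 1) div 2) = hankel q (alpha_shift \<alpha> (\<lambda>j. emb (s' j))) ((m - 1) div 2)" if "m \<noteq> 0"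
  proof (intro hankel_cong)
    fix j assume "j \<le> 2 * ((m - 1) div 2)"
    then have "Suc j \<le> m" using that by presburger
    then show "alpha_shift \<alpha> (\<lambda>j. emb (s j)) j = alpha_shift \<alpha> (\<lambda>j. emb (s' j)) j"
      by (simp add: alpha_shift_def eq)
  qed
  ultimately show ?thesis using s eq by (simp add: K_nonneg_fin_iff[OF q])
qed

text \<open>The Schur transform of an extension of \<open>s\<close> extends the Schur transform of \<open>s\<close>.\<close>

lemma schur_K_ext_fin:
  assumes q: "q > 0" and s: "s(Suc (Suc m) := X) \<in> K_nonneg_fin q \<alpha> (Suc (Suc m))"
  shows "\<exists>Y\<in>carrier_mat q q. (schur_transform q \<alpha> s)(Suc m := Y) \<in> K_nonneg_fin q \<alpha> (Suc m)"
proof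
  define T where "T = schur_transform q \<alpha> (s(Suc (Suc m) := X))"
  have T: "T \<in> K_nonneg_fin q \<alpha> (Suc m)" unfolding T_def by (rule schur_K_nonneg_fin[OF q s])
  have "T j = schur_transform q \<alpha> s j" if "j \<le> m" for j
    unfolding T_def using that by (intro schur_transform_cong) auto
  then show "(schur_transform q \<alpha> s)(Suc m := T (Suc m)) \<in> K_nonneg_fin q \<alpha> (Suc m)"
    by (intro K_nonneg_fin_cong[OF q _ T]) (auto simp: le_Suc_eq)
  show "T (Suc m) \<in> carrier_mat q q" using T by (simp add: K_nonneg_fin_def)
qed

lemma schur_K_cd_fin_order:
  assumes q: "q > 0" and s: "s \<in> K_cd_fin q \<alpha> m"
  shows "schur_transform q \<alpha> s \<in> K_cd_fin q \<alpha> (m - 1)"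
  using assms schur_K_cd_fin_0 schur_K_cd_fin by (cases m) auto

theorem theorem7p21:
  fixes q :: nat and \<alpha> :: real and \<kappa> :: enat and s :: "nat \<Rightarrow> complex mat"
  assumes "q \<ge> 1" and "\<kappa> \<ge> 1"
    and "\<And>j. enat j \<le> \<kappa> \<Longrightarrow> s j \<in> carrier_mat q q"
  shows "(s \<in> K_nonneg q \<alpha> \<kappa> \<longrightarrow> schur_transform q \<alpha> s \<in> K_nonneg q \<alpha> (\<kappa> - 1)) \<and>
    (s \<in> K_ext q \<alpha> \<kappa> \<longrightarrow> schur_transform q \<alpha> s \<in> K_ext q \<alpha> (\<kappa> - 1)) \<and>
    (s \<in> K_pos q \<alpha> \<kappa> \<longrightarrow> schur_transform q \<alpha> s \<in> K_pos q \<alpha> (\<kappa> - 1)) \<and>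
    (\<forall>m::nat. enat m \<le> \<kappa> \<longrightarrow> s \<in> K_cd_order q \<alpha> \<kappa> m \<longrightarrow>
        schur_transform q \<alpha> s \<in> K_cd_order q \<alpha> (\<kappa> - 1) (nat (max 0 (int m - 1)))) \<and>
    (s \<in> K_cd q \<alpha> \<kappa> \<longrightarrow> schur_transform q \<alpha> s \<in> K_cd q \<alpha> (\<kappa> - 1))"
proof -
  have q: "q > 0" using assms(1) by simp
  have order: "nat (max 0 (int m - 1)) = m - 1" for m by linarith
  show ?thesis
  proof (cases \<kappa>)
    case (enat n)
    then obtain m where n: "n = Suc m" using assms(2) by (cases n) (auto simp: one_enat_def)
    have \<kappa>: "\<kappa> = enat (Suc m)" "\<kappa> - 1 = enat m" using enat n by (simp_all add: one_enat_def)
    show ?thesis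
      unfolding \<kappa>(2) unfolding \<kappa>(1) order K_nonneg_def K_ext_def K_pos_def K_cd_order_def K_cd_def enat.case
    proof (intro conjI impI allI)
      assume "s \<in> {s. \<exists>X\<in>carrier_mat q q. s(Suc (Suc m) := X) \<in> K_nonneg_fin q \<alpha> (Suc (Suc m))}"
      then obtain X where "s(Suc (Suc m) := X) \<in> K_nonneg_fin q \<alpha> (Suc (Suc m))" by blast
      then show "schur_transform q \<alpha> s \<in> {s. \<exists>X\<in>carrier_mat q q. s(Suc m := X) \<in> K_nonneg_fin q \<alpha> (Suc m)}"
        using schur_K_ext_fin[OF q] by simp
    qed (use schur_K_nonneg_fin[OF q] schur_K_pos_fin[OF q] schur_K_cd_fin[OF q] schur_K_cd_fin_order[OF q]
         in simp_all)
  next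
    case infinity
    then have \<kappa>: "\<kappa> = \<infinity>" "\<kappa> - 1 = \<infinity>" by simp_all
    have nonneg: "schur_transform q \<alpha> s \<in> (\<Inter>m. K_nonneg_fin q \<alpha> m)" if "s \<in> (\<Inter>m. K_nonneg_fin q \<alpha> m)"
      using that by (auto intro: schur_K_nonneg_fin[OF q])
    have pos: "schur_transform q \<alpha> s \<in> (\<Inter>m. K_pos_fin q \<alpha> m)" if "s \<in> (\<Inter>m. K_pos_fin q \<alpha> m)"
      using that by (auto intro: schur_K_pos_fin[OF q])
    have cd: "\<exists>m. schur_transform q \<alpha> s \<in> K_cd_fin q \<alpha> m" if "s \<in> K_cd_fin q \<alpha> m" for m
      using schur_K_cd_fin_order[OF q that] by blast
    show ?thesis
      unfolding \<kappa>(2) unfolding \<kappa>(1) order K_nonneg_def K_ext_def K_pos_def K_cd_order_def K_cd_def enat.case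
      using nonneg pos cd schur_K_cd_fin_order[OF q] by (intro conjI impI allI) (simp_all only: mem_Collect_eq simp_thms, blast+)
  qed
qed

end
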